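(* Let $K>0$, $t\geqslant 0$, $L_1,L_2>0$ be constants, let $\Omega=[-L_1,L_1]\times[-L_2,L_2]\times[0,1]$ with coordinates $(x,y,z)$, and consider $$I(\mathbf{n})=K\int_\Omega|\nabla\mathbf{n}|^2+2t\,\mathbf{n}\cdot\nabla\times\mathbf{n}+t^2\,dx$$ over the set of admissible mappings $$\mathcal{A}=\Big\{\mathbf{n}\in W^{1,2}(\Omega,\mathbb{S}^2)\,:\,\mathbf{n}|_{z=0}=\mathbf{n}|_{z=1}=\mathbf{e}_3,\ \mathbf{n}|_{x=-L_1}=\mathbf{n}|_{x=L_1},\ \mathbf{n}|_{y=-L_2}=\mathbf{n}|_{y=L_2}\Big\}.$$ If $t<\pi$ then the constant map $\mathbf{n}=\mathbf{e}_3$ is a strict strong local minimizer of $I$. If $t>\pi$ then $\mathbf{n}=\mathbf{e}_3$ is not a weak local minimizer of $I$.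
   Context: $W^{1,2}(\Omega,\mathbb{S}^2)=\{\mathbf{n}\in W^{1,2}(\Omega,\mathbb{R}^3):|\mathbf{n}(x)|=1\text{ a.e.}\}$; boundary conditions are in the sense of traces; $\nabla\times$ is the curl and $\mathbf{e}_3=(0,0,1)$. $\mathbf{n}\in\mathcal{A}$ is a weak local minimizer of $I$ if there is $\epsilon>0$ such that $I(\mathbf{m})\geqslant I(\mathbf{n})$ for all $\mathbf{m}\in\mathcal{A}$ with $\|\mathbf{n}-\mathbf{m}\|_{1,\infty}<\epsilon$ ($W^{1,\infty}$ norm). It is a strict strong local minimizer if there is $\epsilon>0$ such that $I(\mathbf{m})>I(\mathbf{n})$ for all $\mathbf{m}\in\mathcal{A}$ with $0<\|\mathbf{n}-\mathbf{m}\|_\infty<\epsilon$. *)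

theory Defs
  imports "HOL-Analysis.Analysis" "HOL-Probability.Essential_Supremum"
begin

section \<open>Smooth functions, weak gradients and Sobolev spaces\<close>

primrec C_k :: "nat \<Rightarrow> (real^'n \<Rightarrow> 'b::real_normed_vector) \<Rightarrow> bool" where
  "C_k 0 f \<longleftrightarrow> continuous_on UNIV f"
| "C_k (Suc k) f \<longleftrightarrow> (\<forall>x. f differentiable (at x)) \<and>
     (\<forall>j. C_k k (\<lambda>x. frechet_derivative f (at x) (axis j 1)))"

definition smooth :: "(real^'n \<Rightarrow> 'b::real_normed_vector) \<Rightarrow> bool" where
  "smooth f \<longleftrightarrow> (\<forall>k. C_k k f)"

definition test_function :: "(real^'n) set \<Rightarrow> (real^'n \<Rightarrow> real) \<Rightarrow> bool" where
  "test_function \<Omega> \<phi> \<longleftrightarrow> smooth \<phi> \<and>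
     compact (closure {x. \<phi> x \<noteq> 0}) \<and> closure {x. \<phi> x \<noteq> 0} \<subseteq> interior \<Omega>"

text \<open>
  Domains may be given as closed sets (here a closed box, whose boundary is a null set); derivatives
  are taken in the interior. As for the classical Jacobian, \<open>G x $ i $ j\<close> is the \<open>j\<close>-th partial
  derivative of the \<open>i\<close>-th component.
\<close>

definition is_weak_gradient ::
    "(real^'n) set \<Rightarrow> (real^'n \<Rightarrow> real^'m) \<Rightarrow> (real^'n \<Rightarrow> real^'n^'m) \<Rightarrow> bool" where
  "is_weak_gradient \<Omega> u G \<longleftrightarrow>
     (\<forall>C. compact C \<and> C \<subseteq> interior \<Omega> \<longrightarrow>
        u absolutely_integrable_on C \<and> G absolutely_integrable_on C) \<and>
     (\<forall>\<phi> i j. test_function \<Omega> \<phi> \<longrightarrow>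
        (LINT x|lebesgue_on \<Omega>. u x $ i * frechet_derivative \<phi> (at x) (axis j 1)) =
        - (LINT x|lebesgue_on \<Omega>. G x $ i $ j * \<phi> x))"

text \<open>
  The weak gradient is unique up to null sets; we choose a representative. The value is
  meaningless if \<open>u\<close> has no weak gradient.
\<close>

definition weak_grad :: "(real^'n) set \<Rightarrow> (real^'n \<Rightarrow> real^'m) \<Rightarrow> real^'n \<Rightarrow> real^'n^'m" where
  "weak_grad \<Omega> u = (SOME G. is_weak_gradient \<Omega> u G)"

definition in_L2 :: "'a::euclidean_space set \<Rightarrow> ('a \<Rightarrow> 'b::euclidean_space) \<Rightarrow> bool" where
  "in_L2 S f \<longleftrightarrow> f \<in> borel_measurable (lebesgue_on S) \<and>
     integrable (lebesgue_on S) (\<lambda>x. (norm (f x))\<^sup>2)"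

definition L2_tendsto ::
    "'a::euclidean_space set \<Rightarrow> (nat \<Rightarrow> 'a \<Rightarrow> 'b::euclidean_space) \<Rightarrow> ('a \<Rightarrow> 'b) \<Rightarrow> bool" where
  "L2_tendsto S F f \<longleftrightarrow> (\<forall>k. in_L2 S (F k)) \<and> in_L2 S f \<and>
     (\<lambda>k. LINT x|lebesgue_on S. (norm (F k x - f x))\<^sup>2) \<longlonglongrightarrow> 0"

definition W12 :: "(real^'n) set \<Rightarrow> (real^'n \<Rightarrow> real^'m) set" where
  "W12 \<Omega> = {u. in_L2 \<Omega> u \<and> (\<exists>G. is_weak_gradient \<Omega> u G \<and> in_L2 \<Omega> G)}"

definition W12_sphere :: "(real^'n) set \<Rightarrow> (real^'n \<Rightarrow> real^'m) set" where
  "W12_sphere \<Omega> = {u \<in> W12 \<Omega>. AE x in lebesgue_on \<Omega>. norm (u x) = 1}"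

definition Linf_norm :: "(real^'n) set \<Rightarrow> (real^'n \<Rightarrow> 'b::euclidean_space) \<Rightarrow> ereal" where
  "Linf_norm \<Omega> u = esssup (lebesgue_on \<Omega>) (\<lambda>x. ereal (norm (u x)))"

definition W1inf_norm :: "(real^'n) set \<Rightarrow> (real^'n \<Rightarrow> real^'m) \<Rightarrow> ereal" where
  "W1inf_norm \<Omega> u =
     (if \<exists>G. is_weak_gradient \<Omega> u G then Linf_norm \<Omega> u + Linf_norm \<Omega> (weak_grad \<Omega> u) else \<infinity>)"

section \<open>Local minimizers\<close>

definition weak_local_minimizer ::
    "(real^'n) set \<Rightarrow> (real^'n \<Rightarrow> real^'m) set \<Rightarrow> ((real^'n \<Rightarrow> real^'m) \<Rightarrow> real) \<Rightarrow>
     (real^'n \<Rightarrow> real^'m) \<Rightarrow> bool" where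
  "weak_local_minimizer \<Omega> A J n \<longleftrightarrow> n \<in> A \<and>
     (\<exists>\<epsilon>::real>0. \<forall>m\<in>A. W1inf_norm \<Omega> (\<lambda>x. n x - m x) < ereal \<epsilon> \<longrightarrow> J m \<ge> J n)"

definition strict_strong_local_minimizer ::
    "(real^'n) set \<Rightarrow> (real^'n \<Rightarrow> real^'m) set \<Rightarrow> ((real^'n \<Rightarrow> real^'m) \<Rightarrow> real) \<Rightarrow>
     (real^'n \<Rightarrow> real^'m) \<Rightarrow> bool" where
  "strict_strong_local_minimizer \<Omega> A J n \<longleftrightarrow> n \<in> A \<and>
     (\<exists>\<epsilon>::real>0. \<forall>m\<in>A. 0 < Linf_norm \<Omega> (\<lambda>x. n x - m x) \<and>
        Linf_norm \<Omega> (\<lambda>x. n x - m x) < ereal \<epsilon> \<longrightarrow> J m > J n)"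

section \<open>The box, traces and the functional\<close>

definition box_domain :: "real \<Rightarrow> real \<Rightarrow> (real^3) set" where
  "box_domain L1 L2 = cbox (vector [- L1, - L2, 0]) (vector [L1, L2, 1])"

definition x_face :: "real \<Rightarrow> real \<times> real \<Rightarrow> real^3" where
  "x_face c p = vector [c, fst p, snd p]"

definition y_face :: "real \<Rightarrow> real \<times> real \<Rightarrow> real^3" where
  "y_face c p = vector [fst p, c, snd p]"

definition z_face :: "real \<Rightarrow> real \<times> real \<Rightarrow> real^3" where
  "z_face c p = vector [fst p, snd p, c]"

text \<open>
  The trace operator is the continuous extension to \<open>W12\<close> of the restriction of functions smooth
  up to the boundary, as a map into \<open>L2\<close> of the boundary with surface measure; on each face,
  surface measure is Lebesgue measure in the two free coordinates. Thus \<open>g\<close>, of which only the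
  values on the boundary matter, is a trace of \<open>u\<close> iff restrictions of some smooth functions
  approximating \<open>u\<close> in \<open>W12\<close> converge to \<open>g\<close> in \<open>L2\<close> on all six faces.
\<close>

definition has_trace :: "real \<Rightarrow> real \<Rightarrow> (real^3 \<Rightarrow> real^3) \<Rightarrow> (real^3 \<Rightarrow> real^3) \<Rightarrow> bool" where
  "has_trace L1 L2 u g \<longleftrightarrow>
     (\<exists>v :: nat \<Rightarrow> real^3 \<Rightarrow> real^3.
        (\<forall>k. smooth (v k)) \<and>
        L2_tendsto (box_domain L1 L2) v u \<and>
        L2_tendsto (box_domain L1 L2) (\<lambda>k x. jacobian (v k) (at x)) (weak_grad (box_domain L1 L2) u) \<and>
        (\<forall>c\<in>{- L1, L1}. L2_tendsto ({- L2..L2} \<times> {0..1}) (\<lambda>k p. v k (x_face c p)) (\<lambda>p. g (x_face c p))) \<and>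
        (\<forall>c\<in>{- L2, L2}. L2_tendsto ({- L1..L1} \<times> {0..1}) (\<lambda>k p. v k (y_face c p)) (\<lambda>p. g (y_face c p))) \<and>
        (\<forall>c\<in>{0, 1}. L2_tendsto ({- L1..L1} \<times> {- L2..L2}) (\<lambda>k p. v k (z_face c p)) (\<lambda>p. g (z_face c p))))"

definition e3 :: "real^3" where
  "e3 = vector [0, 0, 1]"

definition admissible :: "real \<Rightarrow> real \<Rightarrow> (real^3 \<Rightarrow> real^3) set" where
  "admissible L1 L2 = {n \<in> W12_sphere (box_domain L1 L2). \<exists>g. has_trace L1 L2 n g \<and>
     (AE p in lebesgue_on ({- L1..L1} \<times> {- L2..L2}). g (z_face 0 p) = e3) \<and>
     (AE p in lebesgue_on ({- L1..L1} \<times> {- L2..L2}). g (z_face 1 p) = e3) \<and>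
     (AE p in lebesgue_on ({- L2..L2} \<times> {0..1}). g (x_face (- L1) p) = g (x_face L1 p)) \<and>
     (AE p in lebesgue_on ({- L1..L1} \<times> {0..1}). g (y_face (- L2) p) = g (y_face L2 p))}"

definition curl_of_grad :: "real^3^3 \<Rightarrow> real^3" where
  "curl_of_grad G = vector [G$3$2 - G$2$3, G$1$3 - G$3$1, G$2$1 - G$1$2]"

definition weak_curl :: "(real^3) set \<Rightarrow> (real^3 \<Rightarrow> real^3) \<Rightarrow> real^3 \<Rightarrow> real^3" where
  "weak_curl \<Omega> n x = curl_of_grad (weak_grad \<Omega> n x)"

text \<open>The norm of type \<^typ>\<open>real^3^3\<close> is the Frobenius norm.\<close>

definition energy :: "real \<Rightarrow> real \<Rightarrow> real \<Rightarrow> real \<Rightarrow> (real^3 \<Rightarrow> real^3) \<Rightarrow> real" where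
  "energy K t L1 L2 n = K * (LINT x|lebesgue_on (box_domain L1 L2).
     (norm (weak_grad (box_domain L1 L2) n x))\<^sup>2
     + 2 * t * (n x \<bullet> weak_curl (box_domain L1 L2) n x) + t\<^sup>2)"

end

theory Submission
  imports Defs "HOL-Complex_Analysis.Cauchy_Integral_Formula"
begin

text \<open>
  The constant field has energy \<open>K t^2\<close> times the volume, so the claim is about the sign of the
  integral of \<open>|G|^2 + 2 t (n \<bullet> curl n)\<close>, where \<open>G\<close> is the weak gradient of \<open>n\<close>. Close to \<open>e3\<close> the
  sign is decided by the terms with derivatives of \<open>n1\<close>, \<open>n2\<close> in the height \<open>z\<close>:
  \<open>n1'^2 + n2'^2 + 2 t (n2 n1' - n1 n2')\<close>, with zero values at \<open>z = 0\<close> and \<open>z = 1\<close>. In a frame that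
  turns with the height at rate \<open>t\<close> this is \<open>|f'|^2 - t^2 |f|^2\<close>, and \<open>pi^2\<close> is the best constant in
  the Poincare inequality for functions vanishing at the ends of the unit interval. Hence the
  critical twist \<open>pi\<close>.

  Below it, choose \<open>t < s < pi\<close> and \<open>w z = s tan (s (z - 1/2))\<close>, a bounded solution of
  \<open>w' = s^2 + w^2\<close>. Adding the total derivative of \<open>w (n1^2 + n2^2)\<close>, which integrates to \<open>0\<close>,
  completes the squares and leaves \<open>(s^2 - t^2) (n1^2 + n2^2)\<close>; this is Poincare's inequality in the
  turning frame, with a weight that stays bounded at the ends. The remaining part of the curl term
  contains horizontal derivatives. Periodicity allows moving all of them from \<open>n3\<close> to \<open>n1\<close>, \<open>n2\<close> and
  replacing \<open>n3\<close> by \<open>n3 - 1\<close>. Since \<open>|n| = 1\<close>, the latter is quadratic in \<open>n1\<close>, \<open>n2\<close>, so this part is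
  of third order, and smallness of \<open>n - e3\<close> in the supremum norm suffices to absorb it
  (\<open>energy_density_lower_bound\<close>, \<open>energy_excess_lower_bound\<close>). The excess then controls the integral
  of \<open>1 - n3\<close>, which is positive unless \<open>n = e3\<close>.

  Above it, an explicit family of helices lowers the energy: the tilt \<open>\<delta> sin (pi z)\<close> is the optimal
  function for Poincare's inequality, the azimuth \<open>t z\<close> follows the turning frame
  (\<open>helix_energy_less\<close>), and its distance to \<open>e3\<close> in \<open>W1inf_norm\<close> is of order \<open>\<delta>\<close> (\<open>helix_close\<close>).

  Two foundations are needed. Integration by parts for Sobolev fields with traces
  (\<open>integration_by_parts\<close>) passes from smooth approximations to the limit in the divergence theorem
  on the box. To evaluate the energy of an explicit smooth field one has to know its weak gradient,
  which is an arbitrarily chosen representative; uniqueness almost everywhere (\<open>weak_grad_eq\<close>)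
  rests on the fundamental lemma of the calculus of variations and so on smooth bump functions.
\<close>

section \<open>Smooth functions\<close>

lemma has_derivative_imp_frechet:
  "(f has_derivative D) (at x) \<Longrightarrow> frechet_derivative f (at x) = D"
  using frechet_derivative_at by blast

lemma C_k_Suc_imp_C_k: "C_k (Suc k) f \<Longrightarrow> C_k k f"
proof (induction k arbitrary: f)
  case 0
  then show ?case
    by (auto simp: continuous_on_eq_continuous_within intro!: differentiable_imp_continuous_within)
next
  case (Suc k)
  then show ?case by (metis C_k.simps(2))
qed

lemma C_k_zero: "C_k k (\<lambda>x. 0)"
  by (induction k) (auto simp: frechet_derivative_const)

lemma C_k_add: "C_k k f \<Longrightarrow> C_k k g \<Longrightarrow> C_k k (\<lambda>x. f x + g x)"
proof (induction k arbitrary: f g)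
  case 0
  then show ?case by (auto intro: continuous_intros)
next
  case (Suc k)
  have "frechet_derivative (\<lambda>x. f x + g x) (at x) (axis j 1)
      = frechet_derivative f (at x) (axis j 1) + frechet_derivative g (at x) (axis j 1)" for x j
    using Suc.prems by (subst has_derivative_imp_frechet[OF has_derivative_add])
      (auto simp flip: frechet_derivative_works)
  with Suc show ?case by simp
qed

lemma C_k_diff: "C_k k f \<Longrightarrow> C_k k g \<Longrightarrow> C_k k (\<lambda>x. f x - g x)"
proof (induction k arbitrary: f g)
  case 0
  then show ?case by (auto intro: continuous_intros)
next
  case (Suc k)
  have "frechet_derivative (\<lambda>x. f x - g x) (at x) (axis j 1)
      = frechet_derivative f (at x) (axis j 1) - frechet_derivative g (at x) (axis j 1)" for x j
    using Suc.prems by (subst has_derivative_imp_frechet[OF has_derivative_diff])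
      (auto simp flip: frechet_derivative_works)
  with Suc show ?case by simp
qed

lemma C_k_const: "C_k k (\<lambda>x. c)"
  by (cases k) (auto simp: frechet_derivative_const C_k_zero)

lemma C_k_mult:
  fixes f g :: "real^'n \<Rightarrow> real"
  shows "C_k k f \<Longrightarrow> C_k k g \<Longrightarrow> C_k k (\<lambda>x. f x * g x)"
proof (induction k arbitrary: f g)
  case 0
  then show ?case by (auto intro: continuous_intros)
next
  case (Suc k)
  have "frechet_derivative (\<lambda>x. f x * g x) (at x) (axis j 1)
      = f x * frechet_derivative g (at x) (axis j 1) + frechet_derivative f (at x) (axis j 1) * g x" for x j
    using Suc.prems by (subst has_derivative_imp_frechet[OF has_derivative_mult])
      (auto simp flip: frechet_derivative_works)
  moreover have "C_k k f" "C_k k g" using Suc.prems by (auto intro: C_k_Suc_imp_C_k simp del: C_k.simps)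
  ultimately show ?case using Suc by (auto intro!: C_k_add)
qed

lemma smooth_mult:
  fixes f g :: "real^'n \<Rightarrow> real"
  shows "smooth f \<Longrightarrow> smooth g \<Longrightarrow> smooth (\<lambda>x. f x * g x)"
  by (simp add: smooth_def C_k_mult)

lemma smooth_prod:
  fixes f :: "'i \<Rightarrow> real^'n \<Rightarrow> real"
  assumes "finite I" "I \<noteq> {}" "\<And>i. i \<in> I \<Longrightarrow> smooth (f i)"
  shows "smooth (\<lambda>x. \<Prod>i\<in>I. f i x)"
  using assms by (induction rule: finite_ne_induct) (auto intro: smooth_mult)

lemma has_derivative_profile:
  assumes "(h has_vector_derivative h') (at ((x::real^'n) $ i))"
  shows "((\<lambda>x::real^'n. h (x $ i)) has_derivative (\<lambda>v. (v $ i) *\<^sub>R h')) (at x)"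
proof -
  have "((\<lambda>x::real^'n. x $ i) has_derivative (\<lambda>v. v $ i)) (at x)"
    by (intro bounded_linear_imp_has_derivative bounded_linear_vec_nth)
  moreover have "(h has_derivative (\<lambda>c. c *\<^sub>R h')) (at (x $ i))"
    using assms by (simp add: has_vector_derivative_def)
  ultimately show ?thesis
    using has_derivative_compose by blast
qed

text \<open>By the chain rule, differentiating a profile of one coordinate gives again such a profile or
  zero. Hence it suffices that the profile lies in a class of functions of one variable that
  contains a derivative of each of its members.\<close>

lemma smooth_profile:
  fixes h :: "real \<Rightarrow> 'b::real_normed_vector"
  assumes "h \<in> S"
    and S: "\<And>h. h \<in> S \<Longrightarrow> \<exists>h'\<in>S. \<forall>c. (h has_vector_derivative h' c) (at c)"
  shows "smooth (\<lambda>x::real^'n. h (x $ i))"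
proof -
  have "C_k k (\<lambda>x::real^'n. h (x $ i))" if "h \<in> S" for k h
    using that
  proof (induction k arbitrary: h)
    case 0
    then obtain h' where "\<And>c. (h has_vector_derivative h' c) (at c)" using S by blast
    then have "isCont h c" for c
      using has_vector_derivative_continuous by blast
    then have "continuous_on UNIV h" by (simp add: continuous_at_imp_continuous_on)
    then have "continuous_on UNIV (\<lambda>x::real^'n. h (x $ i))"
      by (rule continuous_on_compose2) (auto intro: continuous_intros)
    then show ?case by simp
  next
    case (Suc k)
    then obtain h' where h': "h' \<in> S" "\<And>c. (h has_vector_derivative h' c) (at c)" using S by blast
    have d: "((\<lambda>x::real^'n. h (x $ i)) has_derivative (\<lambda>v. (v $ i) *\<^sub>R h' (x $ i))) (at x)" for x
      by (rule has_derivative_profile) (rule h')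
    have "C_k k (\<lambda>x::real^'n. (axis j 1 $ i) *\<^sub>R h' (x $ i))" for j
      using Suc.IH[OF h'(1)] C_k_zero by (cases "i = j") (auto simp: axis_def)
    then show ?case
      using d by (auto simp: has_derivative_imp_frechet[OF d] differentiable_def)
  qed
  with assms(1) show ?thesis by (simp add: smooth_def)
qed

subsection \<open>Profiles that are restrictions of entire functions\<close>

lemma has_vector_derivative_Re_holomorphic:
  assumes "H holomorphic_on UNIV"
  shows "((\<lambda>c::real. Re (H (of_real c))) has_vector_derivative Re (deriv H (of_real c))) (at c)"
proof -
  have "(H has_field_derivative deriv H (of_real c)) (at (of_real c))"
    using assms by (intro holomorphic_derivI[of H UNIV]) auto
  then have "((\<lambda>c::real. H (of_real c)) has_vector_derivative deriv H (of_real c)) (at c)"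
    by (rule has_vector_derivative_real_field)
  then show ?thesis
    by (rule bounded_linear.has_vector_derivative[OF bounded_linear_Re])
qed

lemma has_vector_derivative_vec_lambda:
  assumes "\<And>i. ((\<lambda>c. f c i) has_vector_derivative f' i) (at c)"
  shows "((\<lambda>c. (\<chi> i. f c i) :: real^'n) has_vector_derivative (\<chi> i. f' i)) (at c)"
  using assms unfolding has_vector_derivative_def
  by (subst has_derivative_componentwise_within)
    (auto simp: Basis_vec_def inner_axis)

text \<open>Entire functions are closed under differentiation, so this shows smoothness of elementary
  profiles without computing their derivatives.\<close>

lemma smooth_entire_profile:
  fixes H :: "'m::finite \<Rightarrow> complex \<Rightarrow> complex"
  assumes "\<And>a. H a holomorphic_on UNIV"
  shows "smooth (\<lambda>x::real^'n. (\<chi> a. Re (H a (of_real (x $ i)))) :: real^'m)"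
proof -
  define S :: "(real \<Rightarrow> real^'m) set"
    where "S = {\<lambda>c. \<chi> a. Re (H a (of_real c)) | H. \<forall>a. H a holomorphic_on UNIV}"
  show ?thesis
  proof (rule smooth_profile[where h = "\<lambda>c. \<chi> a. Re (H a (of_real c))" and S = S])
    show "(\<lambda>c. \<chi> a. Re (H a (of_real c))) \<in> S"
      using assms unfolding S_def by blast
    fix h assume "h \<in> S"
    then obtain H where H: "h = (\<lambda>c. \<chi> a. Re (H a (of_real c)))" "\<And>a. H a holomorphic_on UNIV"
      unfolding S_def by blast
    have "(\<lambda>c. \<chi> a. Re (deriv (H a) (of_real c))) \<in> S"
      unfolding S_def using H(2) by (intro CollectI exI[of _ "\<lambda>a. deriv (H a)"]) (auto intro!: holomorphic_deriv)
    moreover have "(h has_vector_derivative (\<chi> a. Re (deriv (H a) (of_real c)))) (at c)" for c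
      unfolding H(1) by (intro has_vector_derivative_vec_lambda has_vector_derivative_Re_holomorphic H)
    ultimately show "\<exists>h'\<in>S. \<forall>c. (h has_vector_derivative h' c) (at c)"
      by (intro bexI[of _ "\<lambda>c. \<chi> a. Re (deriv (H a) (of_real c))"] allI)
  qed
qed

subsection \<open>Bump functions\<close>

text \<open>The functions \<open>p (1/x) * exp (-1/x)\<close>, extended by \<open>0\<close> to \<open>x \<le> 0\<close>. They are
  closed under differentiation: in terms of \<open>y = 1/x\<close>, the derivative replaces \<open>p\<close> by
  \<open>y^2 * (p - p')\<close>.\<close>

definition flat :: "real poly \<Rightarrow> real \<Rightarrow> real" where
  "flat p x = (if x \<le> 0 then 0 else poly p (1 / x) * exp (- (1 / x)))"

lemma poly_exp_minus_tendsto_0: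
  "((\<lambda>y::real. poly p y * exp (- y)) \<longlongrightarrow> 0) at_top"
proof -
  have "((\<lambda>y::real. \<Sum>i\<le>degree p. coeff p i * (y ^ i / exp y)) \<longlongrightarrow> (\<Sum>i\<le>degree p. coeff p i * 0)) at_top"
    by (intro tendsto_intros tendsto_power_div_exp_0)
  moreover have "poly p y * exp (- y) = (\<Sum>i\<le>degree p. coeff p i * (y ^ i / exp y))" for y :: real
    by (simp add: poly_altdef exp_minus sum_distrib_left sum_distrib_right field_simps)
  ultimately show ?thesis by simp
qed

lemma flat_deriv:
  "(flat p has_real_derivative flat ([:0, 0, 1:] * (p - pderiv p)) x) (at x)"
proof -
  consider "x > 0" | "x < 0" | "x = 0" by linarith
  then show ?thesis
  proof cases
    case 1
    have "((\<lambda>x. poly p (1 / x) * exp (- (1 / x))) has_real_derivative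
       flat ([:0, 0, 1:] * (p - pderiv p)) x) (at x)"
      using 1 by (auto intro!: derivative_eq_intros DERIV_chain'[where g = "poly p"] poly_DERIV
          simp: flat_def field_simps power2_eq_square)
    then show ?thesis
      by (rule has_field_derivative_transform_within_open[where S = "{0<..}"])
        (use 1 in \<open>auto simp: flat_def\<close>)
  next
    case 2
    have "((\<lambda>x. 0) has_real_derivative flat ([:0, 0, 1:] * (p - pderiv p)) x) (at x)"
      using 2 by (simp add: flat_def)
    then show ?thesis
      by (rule has_field_derivative_transform_within_open[where S = "{..<0}"])
        (use 2 in \<open>auto simp: flat_def\<close>)
  next
    case 3
    \<comment> \<open>For \<open>h > 0\<close> the difference quotient at \<open>0\<close> is \<open>y * p y * exp (- y)\<close> with \<open>y = 1/h\<close>.\<close>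
    have "((\<lambda>h. flat p h / h) \<longlongrightarrow> 0) (at_right 0)"
    proof -
      have "((\<lambda>h::real. poly ([:0, 1:] * p) (inverse h) * exp (- (inverse h))) \<longlongrightarrow> 0) (at_right 0)"
        by (rule filterlim_compose[OF poly_exp_minus_tendsto_0 filterlim_inverse_at_top_right])
      then show ?thesis
        by (rule Lim_transform_eventually)
          (auto simp: eventually_at_right_field flat_def field_simps intro!: exI[of _ 1])
    qed
    moreover have "((\<lambda>h. flat p h / h) \<longlongrightarrow> 0) (at_left 0)"
      by (rule tendsto_eventually) (auto simp: eventually_at_left_field flat_def intro!: exI[of _ "-1"])
    ultimately have "((\<lambda>h. flat p h / h) \<longlongrightarrow> 0) (at 0)"
      using filterlim_split_at by blast
    then show ?thesis
      using 3 by (simp add: DERIV_def flat_def)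
  qed
qed

lemma smooth_flat:
  "smooth (\<lambda>x::real^'n. flat p (r * (x $ i) + q))"
proof (rule smooth_profile[where h = "\<lambda>c. flat p (r * c + q)" and S = "{\<lambda>c. s * flat p (r * c + q) | s p. True}"])
  show "(\<lambda>c. flat p (r * c + q)) \<in> {\<lambda>c. s * flat p (r * c + q) | s p. True}"
    by (auto intro!: exI[of _ "1::real"])
  fix h assume "h \<in> {\<lambda>c. s * flat p (r * c + q) | s p. True}"
  then obtain s p where h: "h = (\<lambda>c. s * flat p (r * c + q))" by auto
  have "(h has_real_derivative (s * r) * flat ([:0, 0, 1:] * (p - pderiv p)) (r * c + q)) (at c)" for c
    unfolding h by (auto intro!: derivative_eq_intros DERIV_chain'[OF _ flat_deriv])
  then show "\<exists>h'\<in>{\<lambda>c. s * flat p (r * c + q) | s p. True}. \<forall>c. (h has_vector_derivative h' c) (at c)"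
    by (intro bexI[of _ "\<lambda>c. (s * r) * flat ([:0, 0, 1:] * (p - pderiv p)) (r * c + q)"])
      (auto simp: has_real_derivative_iff_has_vector_derivative)
qed

lemma flat_1_bounds: "0 \<le> flat 1 x" "flat 1 x \<le> 1"
  by (auto simp: flat_def)

lemma flat_1_pos_iff: "flat 1 x \<noteq> 0 \<longleftrightarrow> 0 < x"
  by (auto simp: flat_def)

text \<open>Since \<open>flat 1 (k * x) = exp (-1/x) powr (1/k)\<close> for \<open>x > 0\<close>, these products of one-dimensional
  bumps increase to the indicator of the open box.\<close>

definition box_bump :: "real^'n \<Rightarrow> real^'n \<Rightarrow> nat \<Rightarrow> real^'n \<Rightarrow> real" where
  "box_bump l u k x =
     (\<Prod>i\<in>UNIV. flat 1 (real k * (x $ i - l $ i)) * flat 1 (real k * (u $ i - x $ i)))"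

lemma smooth_box_bump:
  fixes l u :: "real^'n"
  shows "smooth (box_bump l u k)"
proof -
  have "smooth (\<lambda>x::real^'n. flat 1 (real k * (x $ i - l $ i)) * flat 1 (real k * (u $ i - x $ i)))" for i
    using smooth_mult[OF smooth_flat[of 1 "real k" i "- real k * l $ i"] smooth_flat[of 1 "- real k" i "real k * u $ i"]]
    by (simp add: algebra_simps)
  then show ?thesis
    unfolding box_bump_def[abs_def] by (intro smooth_prod) auto
qed

lemma box_bump_nonzero_imp: "box_bump l u k x \<noteq> 0 \<Longrightarrow> x \<in> box l u"
  by (auto simp: box_bump_def flat_1_pos_iff zero_less_mult_iff mem_box_cart)

lemma test_function_box_bump:
  assumes "cbox l u \<subseteq> interior \<Omega>"
  shows "test_function \<Omega> (box_bump l u k)"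
proof -
  have "closure {x. box_bump l u k x \<noteq> 0} \<subseteq> cbox l u"
    using box_bump_nonzero_imp box_subset_cbox by (intro closure_minimal) blast+
  then show ?thesis
    using assms smooth_box_bump unfolding test_function_def
    by (metis bounded_cbox bounded_subset closed_closure compact_eq_bounded_closed subset_trans)
qed

lemma box_bump_bounds: "0 \<le> box_bump l u k x" "box_bump l u k x \<le> 1"
  unfolding box_bump_def
  by (auto intro!: prod_nonneg prod_le_1 mult_nonneg_nonneg mult_le_one flat_1_bounds)

lemma flat_1_dilate_tendsto: "(\<lambda>k. flat 1 (real k * x)) \<longlonglongrightarrow> (if 0 < x then 1 else 0)"
proof (cases "0 < x")
  case True
  have "(\<lambda>k. exp (- (1 / x) * (1 / real k))) \<longlonglongrightarrow> exp (- (1 / x) * 0)"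
    by (intro tendsto_intros lim_1_over_n)
  moreover have "\<forall>\<^sub>F k in sequentially. exp (- (1 / x) * (1 / real k)) = flat 1 (real k * x)"
    using eventually_gt_at_top[of 0]
  proof eventually_elim
    case (elim k)
    then have "\<not> real k * x \<le> 0" using True by (simp add: not_le)
    then show ?case by (simp add: flat_def mult.commute)
  qed
  ultimately show ?thesis
    using True by (auto elim: Lim_transform_eventually)
next
  case False
  then have "real k * x \<le> 0" for k by (simp add: mult_nonneg_nonpos)
  with False show ?thesis by (simp add: flat_def)
qed

lemma box_bump_tendsto: "(\<lambda>k. box_bump l u k x) \<longlonglongrightarrow> indicator (box l u) x"
proof -
  have "(\<lambda>k. box_bump l u k x) \<longlonglongrightarrow>
     (\<Prod>i\<in>UNIV. (if 0 < x $ i - l $ i then 1 else 0) * (if 0 < u $ i - x $ i then 1 else 0))"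
    unfolding box_bump_def by (intro tendsto_prod tendsto_mult flat_1_dilate_tendsto)
  also have "(\<Prod>i\<in>UNIV. (if 0 < x $ i - l $ i then 1 else 0) * (if 0 < u $ i - x $ i then 1 else 0))
      = (indicator (box l u) x :: real)"
    by (auto simp: mem_box_cart indicator_def intro!: prod_zero)
  finally show ?thesis .
qed

section \<open>Uniqueness of weak gradients\<close>

text \<open>Boxes are closed under intersection and generate the Borel sets, so vanishing of the
  integrals carries over from boxes to all Borel sets.\<close>

lemma AE_zero_if_box_integrals_zero:
  fixes D :: "'a::euclidean_space \<Rightarrow> real"
  assumes D[measurable]: "integrable lborel D"
    and zero: "\<And>a b. (LINT x:box a b|lborel. D x) = 0"
  shows "AE x in lborel. D x = 0"
proof -
  have int: "set_integrable lborel A D" if "A \<in> sets borel" for A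
    unfolding set_integrable_def using integrable_mult_indicator[of A lborel D] that D by simp
  have total: "(LINT x|lborel. D x) = 0"
  proof -
    let ?A = "\<lambda>n::nat. box (- (real n *\<^sub>R One)) (real n *\<^sub>R One) :: 'a set"
    have "incseq ?A" by (auto simp: incseq_def mem_box) (smt (verit) of_nat_le_iff)+
    moreover have U: "(\<Union>i. ?A i) = UNIV" by (rule UN_box_eq_UNIV)
    ultimately have "(\<lambda>i. LINT x:?A i|lborel. D x) \<longlonglongrightarrow> (LINT x:UNIV|lborel. D x)"
      using set_integral_cont_up[of ?A lborel D] int[of UNIV] by simp
    then have "(LINT x:UNIV|lborel. D x) = 0"
      unfolding zero by (simp add: LIMSEQ_const_iff)
    then show ?thesis by (simp add: set_lebesgue_integral_def)
  qed
  have "(LINT x:A|lborel. D x) = 0" if "A \<in> sets borel" for A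
  proof -
    have "Int_stable (range (\<lambda>(a, b). box a b :: 'a set))"
      by (auto simp: Int_stable_def box_Int_box)
    moreover have "range (\<lambda>(a, b). box a b :: 'a set) \<subseteq> Pow UNIV" by auto
    moreover have "A \<in> sigma_sets UNIV (range (\<lambda>(a, b). box a b))"
      using that unfolding borel_eq_box by simp
    ultimately show ?thesis
    proof (induction rule: sigma_sets_induct_disjoint)
      case (basic A)
      then show ?case using zero by auto
    next
      case empty
      then show ?case by (simp add: set_lebesgue_integral_def)
    next
      case (compl A)
      then have A[measurable]: "A \<in> sets borel" by (simp add: borel_eq_box)
      have "(LINT x:UNIV - A|lborel. D x) = (LINT x|lborel. D x - indicator A x *\<^sub>R D x)"
        unfolding set_lebesgue_integral_def
        by (intro Bochner_Integration.integral_cong) (auto simp: indicator_def)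
      also have "\<dots> = 0 - (LINT x:A|lborel. D x)"
        using int[OF A] D total
        by (subst Bochner_Integration.integral_diff) (auto simp: set_integrable_def set_lebesgue_integral_def)
      finally show ?case using compl by simp
    next
      case (union F)
      then have F: "\<And>i. F i \<in> sets lborel" by (simp add: borel_eq_box subset_eq)
      then have "(\<Union>i. F i) \<in> sets borel" by auto
      then have "(LINT x:(\<Union>i. F i)|lborel. D x) = (\<Sum>i. LINT x:F i|lborel. D x)"
        using union by (intro lebesgue_integral_countable_add F int) (auto simp: disjoint_family_on_def)
      then show ?case using union by simp
    qed
  qed
  then show ?thesis
    by (intro density_unique_real) (auto simp: D set_lebesgue_integral_def)
qed

text \<open>The bumps supported in a box are test functions and converge to its indicator, dominated
  by the indicator of the closed box.\<close>

lemma test_integrals_zero_imp_box_integral_zero: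
  fixes D :: "real^'n \<Rightarrow> real"
  assumes loc: "\<And>C. compact C \<Longrightarrow> C \<subseteq> interior \<Omega> \<Longrightarrow> D absolutely_integrable_on C"
    and test: "\<And>\<phi>. test_function \<Omega> \<phi> \<Longrightarrow> (LINT x|lebesgue_on \<Omega>. D x * \<phi> x) = 0"
    and \<Omega>: "\<Omega> \<in> sets lebesgue"
    and ab: "cbox a b \<subseteq> interior \<Omega>"
  shows "(LINT x:box a b|lebesgue. D x) = 0"
proof -
  define E where "E = (\<lambda>x. indicator (cbox a b) x *\<^sub>R D x)"
  have E: "integrable lebesgue E"
    using loc[OF compact_cbox ab] by (simp add: E_def set_integrable_def)
  then have Em: "E \<in> borel_measurable lebesgue" by (rule borel_measurable_integrable)
  have bm: "box_bump a b k \<in> borel_measurable lebesgue" for k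
  proof -
    have "C_k 0 (box_bump a b k)" using smooth_box_bump unfolding smooth_def by blast
    then show ?thesis by (auto intro!: measurable_completion borel_measurable_continuous_onI)
  qed
  have "(\<lambda>k. LINT x|lebesgue. E x * box_bump a b k x) \<longlonglongrightarrow> (LINT x|lebesgue. indicator (box a b) x *\<^sub>R D x)"
  proof (rule integral_dominated_convergence[where w = "\<lambda>x. norm (E x)"])
    show "(\<lambda>x. indicator (box a b) x *\<^sub>R D x) \<in> borel_measurable lebesgue"
    proof -
      have "(\<lambda>x. indicator (box a b) x *\<^sub>R E x) \<in> borel_measurable lebesgue"
        by (intro borel_measurable_scaleR borel_measurable_indicator Em) auto
      moreover have "(\<lambda>x. indicator (box a b) x *\<^sub>R E x) = (\<lambda>x. indicator (box a b) x *\<^sub>R D x)"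
        using box_subset_cbox[of a b] by (auto simp: E_def indicator_def fun_eq_iff)
      ultimately show ?thesis by argo
    qed
    show "(\<lambda>x. E x * box_bump a b k x) \<in> borel_measurable lebesgue" for k
      by (intro borel_measurable_times Em bm)
    show "integrable lebesgue (\<lambda>x. norm (E x))" using E by simp
    show "AE x in lebesgue. (\<lambda>k. E x * box_bump a b k x) \<longlonglongrightarrow> indicator (box a b) x *\<^sub>R D x"
    proof (rule AE_I2)
      fix x
      have "(\<lambda>k. E x * box_bump a b k x) \<longlonglongrightarrow> E x * indicator (box a b) x"
        by (intro tendsto_mult tendsto_const box_bump_tendsto)
      moreover have "E x * indicator (box a b) x = indicator (box a b) x *\<^sub>R D x"
        using box_subset_cbox[of a b] by (auto simp: E_def indicator_def)
      ultimately show "(\<lambda>k. E x * box_bump a b k x) \<longlonglongrightarrow> indicator (box a b) x *\<^sub>R D x" by simp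
    qed
    show "AE x in lebesgue. norm (E x * box_bump a b k x) \<le> norm (E x)" for k
      using box_bump_bounds[of a b k] by (intro AE_I2) (auto simp: abs_mult intro!: mult_left_le)
  qed
  moreover have "(LINT x|lebesgue. E x * box_bump a b k x) = 0" for k
  proof -
    have "(LINT x|lebesgue. E x * box_bump a b k x) = (LINT x|lebesgue. indicator \<Omega> x *\<^sub>R (D x * box_bump a b k x))"
    proof (rule Bochner_Integration.integral_cong)
      fix x
      show "E x * box_bump a b k x = indicator \<Omega> x *\<^sub>R (D x * box_bump a b k x)"
      proof (cases "box_bump a b k x = 0")
        case False
        then have "x \<in> cbox a b" using box_bump_nonzero_imp[OF False] box_subset_cbox by blast
        then have "x \<in> \<Omega>" using ab interior_subset[of \<Omega>] by blast
        with \<open>x \<in> cbox a b\<close> show ?thesis by (simp add: E_def)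
      qed simp
    qed simp
    also have "\<dots> = (LINT x|lebesgue_on \<Omega>. D x * box_bump a b k x)"
      using \<Omega> by (subst integral_restrict_space) auto
    also have "\<dots> = 0" by (intro test test_function_box_bump ab)
    finally show ?thesis .
  qed
  ultimately show ?thesis by (simp add: LIMSEQ_const_iff set_lebesgue_integral_def)
qed

text \<open>The interior is a countable union of closed boxes. On each of them \<open>D\<close> agrees almost
  everywhere with an integrable Borel function, whose integrals over boxes vanish.\<close>

lemma fundamental_lemma:
  fixes D :: "real^'n \<Rightarrow> real"
  assumes loc: "\<And>C. compact C \<Longrightarrow> C \<subseteq> interior \<Omega> \<Longrightarrow> D absolutely_integrable_on C"
    and test: "\<And>\<phi>. test_function \<Omega> \<phi> \<Longrightarrow> (LINT x|lebesgue_on \<Omega>. D x * \<phi> x) = 0"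
    and \<Omega>: "\<Omega> \<in> sets lebesgue"
  shows "AE x in lebesgue. x \<in> interior \<Omega> \<longrightarrow> D x = 0"
proof -
  have box: "AE x in lebesgue. x \<in> cbox c d \<longrightarrow> D x = 0" if cd: "cbox c d \<subseteq> interior \<Omega>" for c d
  proof -
    have E: "integrable lebesgue (\<lambda>x. indicator (cbox c d) x *\<^sub>R D x)"
      using loc[OF compact_cbox cd] by (simp add: set_integrable_def)
    then have "(\<lambda>x. indicator (cbox c d) x *\<^sub>R D x) \<in> borel_measurable lebesgue"
      by (rule borel_measurable_integrable)
    then obtain D' where D'[measurable]: "D' \<in> borel_measurable lborel"
      and eq: "AE x in lborel. indicator (cbox c d) x *\<^sub>R D x = D' x"
      by (blast dest: completion_ex_borel_measurable_real)
    have eq': "AE x in lebesgue. indicator (cbox c d) x *\<^sub>R D x = D' x"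
      using eq by (rule AE_completion)
    have "integrable lebesgue D'"
      using eq' by (rule integrable_cong_AE_imp[OF E _ , rotated])
        (auto intro!: measurable_completion)
    then have intD': "integrable lborel D'"
      using D' by (simp add: integrable_completion)
    have "(LINT x:box a b|lborel. D' x) = 0" for a b
    proof -
      obtain a' b' where I: "box a b \<inter> box c d = box a' b'" "cbox a b \<inter> cbox c d = cbox a' b'"
        by (rule that[OF box_Int_box Int_interval])
      have "(LINT x:box a b|lborel. D' x) = (LINT x|lebesgue. indicator (box a b) x *\<^sub>R D' x)"
        unfolding set_lebesgue_integral_def by (rule integral_completion[symmetric]) measurable
      also have "\<dots> = (LINT x|lebesgue. indicator (box a' b') x *\<^sub>R D x)"
      proof (rule integral_cong_AE)
        have "negligible (cbox c d - box c d)" by (rule negligible_frontier_interval)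
        then have "AE x in lebesgue. x \<notin> cbox c d - box c d"
          unfolding negligible_iff_null_sets by (rule AE_not_in)
        then show ae: "AE x in lebesgue. indicator (box a b) x *\<^sub>R D' x = indicator (box a' b') x *\<^sub>R D x"
          using eq'
        proof eventually_elim
          case (elim x)
          have "x \<in> box a' b' \<longleftrightarrow> x \<in> box a b \<and> x \<in> box c d" using I(1) by blast
          moreover have "x \<in> box c d \<longrightarrow> x \<in> cbox c d" using box_subset_cbox by blast
          ultimately show ?case using elim by (auto simp: indicator_def split: if_splits)
        qed
        show "(\<lambda>x. indicator (box a b) x *\<^sub>R D' x) \<in> borel_measurable lebesgue"
          by (intro measurable_completion) measurable
        then show "(\<lambda>x. indicator (box a' b') x *\<^sub>R D x) \<in> borel_measurable lebesgue"
          using ae by (rule borel_measurable_AE)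
      qed
      also have "\<dots> = 0"
        using test_integrals_zero_imp_box_integral_zero[OF loc test \<Omega>, of a' b'] I(2) cd
        by (simp add: set_lebesgue_integral_def) blast
      finally show ?thesis .
    qed
    with intD' have "AE x in lborel. D' x = 0" by (rule AE_zero_if_box_integrals_zero)
    then have "AE x in lebesgue. D' x = 0" by (rule AE_completion)
    with eq' show ?thesis by eventually_elim auto
  qed
  obtain \<D> where \<D>: "countable \<D>" "\<D> \<subseteq> Pow (interior \<Omega>)"
      "\<And>X. X \<in> \<D> \<Longrightarrow> \<exists>a b. X = cbox a b" "\<Union>\<D> = interior \<Omega>"
    using open_countable_Union_open_cbox[OF open_interior] by metis
  have "AE x in lebesgue. \<forall>X\<in>\<D>. x \<in> X \<longrightarrow> D x = 0"
    using \<D> box by (subst AE_ball_countable) (auto, metis PowD subsetD)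
  then show ?thesis
    by eventually_elim (use \<D>(4) in blast)
qed

lemma test_function_continuous: "test_function \<Omega> \<phi> \<Longrightarrow> continuous_on UNIV \<phi>"
  unfolding test_function_def smooth_def by (metis C_k.simps(1))

lemma integrable_mult_test_function:
  fixes f :: "real^'n \<Rightarrow> real"
  assumes loc: "\<And>C. compact C \<Longrightarrow> C \<subseteq> interior \<Omega> \<Longrightarrow> f absolutely_integrable_on C"
    and \<phi>: "test_function \<Omega> \<phi>" and \<Omega>: "\<Omega> \<in> sets lebesgue"
  shows "integrable (lebesgue_on \<Omega>) (\<lambda>x. f x * \<phi> x)"
proof -
  define K where "K = closure {x. \<phi> x \<noteq> 0}"
  have K: "compact K" "K \<subseteq> interior \<Omega>" using \<phi> by (auto simp: test_function_def K_def)
  have E: "integrable lebesgue (\<lambda>x. indicator K x *\<^sub>R f x)"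
    using loc[OF K] by (simp add: set_integrable_def)
  have "compact (\<phi> ` K)"
    using test_function_continuous[OF \<phi>] K(1) by (meson compact_continuous_image continuous_on_subset subset_UNIV)
  then obtain B where B: "\<And>x. x \<in> K \<Longrightarrow> norm (\<phi> x) \<le> B"
    by (meson bounded_iff compact_imp_bounded imageI)
  have \<phi>m: "\<phi> \<in> borel_measurable lebesgue"
    using test_function_continuous[OF \<phi>] by (auto intro!: measurable_completion borel_measurable_continuous_onI)
  have "integrable lebesgue (\<lambda>x. (indicator K x *\<^sub>R f x) * \<phi> x)"
  proof (rule Bochner_Integration.integrable_bound)
    show "integrable lebesgue (\<lambda>x. B * norm (indicator K x *\<^sub>R f x))" using E by simp
    show "(\<lambda>x. (indicator K x *\<^sub>R f x) * \<phi> x) \<in> borel_measurable lebesgue"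
      by (rule borel_measurable_times[OF borel_measurable_integrable[OF E] \<phi>m])
    show "AE x in lebesgue. norm (indicator K x *\<^sub>R f x * \<phi> x) \<le> norm (B * norm (indicator K x *\<^sub>R f x))"
    proof (rule AE_I2)
      fix x
      show "norm (indicator K x *\<^sub>R f x * \<phi> x) \<le> norm (B * norm (indicator K x *\<^sub>R f x))"
        using mult_left_mono[OF order_trans[OF B[of x] abs_ge_self], of "\<bar>f x\<bar>"]
        by (auto simp: indicator_def abs_mult mult.commute)
    qed
  qed
  moreover have "(\<lambda>x. (indicator K x *\<^sub>R f x) * \<phi> x) = (\<lambda>x. indicator \<Omega> x *\<^sub>R (f x * \<phi> x))"
  proof
    fix x show "(indicator K x *\<^sub>R f x) * \<phi> x = indicator \<Omega> x *\<^sub>R (f x * \<phi> x)"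
    proof (cases "\<phi> x = 0")
      case False
      then have "x \<in> K" using closure_subset by (force simp: K_def)
      then show ?thesis using K interior_subset by fastforce
    qed simp
  qed
  ultimately have "integrable lebesgue (\<lambda>x. indicator \<Omega> x *\<^sub>R (f x * \<phi> x))" by argo
  then show ?thesis
    using \<Omega> by (subst integrable_restrict_space) auto
qed

lemma absolutely_integrable_entry:
  fixes G :: "'a::euclidean_space \<Rightarrow> real^'n^'m"
  shows "G absolutely_integrable_on C \<Longrightarrow> (\<lambda>x. G x $ i $ j) absolutely_integrable_on C"
  using absolutely_integrable_linear[where f = G and s = C and h = "\<lambda>A. A $ i $ j"]
    bounded_linear_compose[OF bounded_linear_vec_nth bounded_linear_vec_nth]
  by (auto simp: o_def)

lemma weak_gradient_unique:
  fixes u :: "real^'n \<Rightarrow> real^'m"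
  assumes G: "is_weak_gradient \<Omega> u G" and G': "is_weak_gradient \<Omega> u G'"
    and \<Omega>: "\<Omega> \<in> sets lebesgue" "negligible (\<Omega> - interior \<Omega>)"
  shows "AE x in lebesgue_on \<Omega>. G x = G' x"
proof -
  have loc: "(\<lambda>x. G x $ i $ j) absolutely_integrable_on C" "(\<lambda>x. G' x $ i $ j) absolutely_integrable_on C"
    if "compact C" "C \<subseteq> interior \<Omega>" for C i j
    using G G' that unfolding is_weak_gradient_def by (auto intro: absolutely_integrable_entry)
  have "AE x in lebesgue. x \<in> interior \<Omega> \<longrightarrow> G x $ i $ j - G' x $ i $ j = 0" for i j
  proof (rule fundamental_lemma)
    show "(\<lambda>x. G x $ i $ j - G' x $ i $ j) absolutely_integrable_on C"
      if "compact C" "C \<subseteq> interior \<Omega>" for C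
      using that by (intro set_integral_diff loc)
    fix \<phi> assume \<phi>: "test_function \<Omega> \<phi>"
    have "(LINT x|lebesgue_on \<Omega>. (G x $ i $ j - G' x $ i $ j) * \<phi> x)
        = (LINT x|lebesgue_on \<Omega>. G x $ i $ j * \<phi> x) - (LINT x|lebesgue_on \<Omega>. G' x $ i $ j * \<phi> x)"
      unfolding left_diff_distrib
      by (intro Bochner_Integration.integral_diff integrable_mult_test_function loc \<phi> \<Omega>)
    also have "\<dots> = 0"
    proof -
      have "- (LINT x|lebesgue_on \<Omega>. G x $ i $ j * \<phi> x) = - (LINT x|lebesgue_on \<Omega>. G' x $ i $ j * \<phi> x)"
        using G G' \<phi> unfolding is_weak_gradient_def by presburger
      then show ?thesis by simp
    qed
    finally show "(LINT x|lebesgue_on \<Omega>. (G x $ i $ j - G' x $ i $ j) * \<phi> x) = 0" .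
  qed (rule \<Omega>)
  then have "AE x in lebesgue. \<forall>i j. x \<in> interior \<Omega> \<longrightarrow> G x $ i $ j - G' x $ i $ j = 0"
    unfolding AE_all_countable by blast
  moreover have "AE x in lebesgue. x \<notin> \<Omega> - interior \<Omega>"
    using \<Omega>(2) unfolding negligible_iff_null_sets by (rule AE_not_in)
  ultimately have "AE x in lebesgue. x \<in> \<Omega> \<longrightarrow> G x = G' x"
    by eventually_elim (auto simp: vec_eq_iff)
  then show ?thesis using \<Omega> by (simp add: AE_restrict_space_iff)
qed

text \<open>Although \<open>weak_grad\<close> is a chosen representative, energy and norms of a field can be computed
  from any weak gradient at hand.\<close>

lemma weak_grad_eq:
  fixes u :: "real^'n \<Rightarrow> real^'m"
  assumes "is_weak_gradient \<Omega> u G" "\<Omega> \<in> sets lebesgue" "negligible (\<Omega> - interior \<Omega>)"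
  shows "AE x in lebesgue_on \<Omega>. weak_grad \<Omega> u x = G x"
proof (rule weak_gradient_unique)
  show "is_weak_gradient \<Omega> u (weak_grad \<Omega> u)"
    unfolding weak_grad_def using assms(1) by (rule someI[where P = "is_weak_gradient \<Omega> u"])
qed (use assms in auto)

section \<open>The divergence theorem on a box\<close>

text \<open>The point with \<open>j\<close>-th coordinate \<open>c\<close> whose coordinates along the axis \<open>a\<close> and the remaining axis are
  given by \<open>p\<close>. One parametrisation for all axes allows treating the three pairs of opposite faces
  of a box at once.\<close>

definition face :: "3 \<Rightarrow> 3 \<Rightarrow> real \<Rightarrow> real \<times> real \<Rightarrow> real^3" where
  "face j a c p = (\<chi> i. if i = j then c else if i = a then fst p else snd p)"

locale axes =
  fixes j a b :: 3
  assumes distinct: "j \<noteq> a" "j \<noteq> b" "a \<noteq> b"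
begin

lemma UNIV_axes: "UNIV = {j, a, b}"
proof -
  have "card {j, a, b} = CARD(3)" using distinct by simp
  then show ?thesis by (intro card_subset_eq[symmetric]) auto
qed

lemma axes_cases: "i = j \<or> i = a \<or> i = b"
  using UNIV_axes by blast

lemma all_axes_iff: "(\<forall>i. P i) \<longleftrightarrow> P j \<and> P a \<and> P b"
  using axes_cases by metis

lemma face_nth [simp]: "face j a c p $ j = c" "face j a c p $ a = fst p" "face j a c p $ b = snd p"
  using distinct by (auto simp: face_def)

lemma face_in_cbox:
  "face j a c p \<in> cbox l u \<longleftrightarrow> c \<in> {l $ j..u $ j} \<and> p \<in> {l $ a..u $ a} \<times> {l $ b..u $ b}"
  by (cases p) (auto simp: mem_box_cart all_axes_iff)

lemma face_in_box:
  "face j a c p \<in> box l u \<longleftrightarrow> c \<in> {l $ j<..<u $ j} \<and> p \<in> {l $ a<..<u $ a} \<times> {l $ b<..<u $ b}"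
  by (cases p) (auto simp: mem_box_cart all_axes_iff)

lemma continuous_on_face: "continuous_on S (\<lambda>q. face j a (f q) (g q))"
  if "continuous_on S f" "continuous_on S g"
  unfolding face_def
proof (rule continuous_on_vec_lambda)
  fix i
  consider "i = j" | "i \<noteq> j" "i = a" | "i \<noteq> j" "i \<noteq> a" by blast
  then show "continuous_on S (\<lambda>q. if i = j then f q else if i = a then fst (g q) else snd (g q))"
    by cases (use that in \<open>auto intro: continuous_on_fst continuous_on_snd\<close>)
qed

lemma measurable_face [measurable]:
  "(\<lambda>(c, p). face j a c p) \<in> borel_measurable (lborel \<Otimes>\<^sub>M lborel)"
proof -
  have "continuous_on UNIV (\<lambda>q. face j a (fst q) (snd q))"
    by (intro continuous_on_face) (auto intro: continuous_intros)
  then show ?thesis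
    by (simp add: case_prod_beta' lborel_prod borel_measurable_continuous_onI)
qed

text \<open>Lebesgue measure on \<open>real^3\<close> is the image of a product measure, which makes Fubini's theorem
  applicable in any coordinate direction.\<close>

lemma lborel_face: "(lborel :: (real^3) measure) = distr (lborel \<Otimes>\<^sub>M lborel) borel (\<lambda>(c, p). face j a c p)"
proof (rule lborel_eqI)
  fix l u :: "real^3" assume le: "\<And>b. b \<in> Basis \<Longrightarrow> l \<bullet> b \<le> u \<bullet> b"
  have le': "l $ i \<le> u $ i" for i
    using le[of "axis i 1"] by (auto simp: inner_axis Basis_vec_def)
  have "(\<lambda>(c, p). face j a c p) -` box l u \<inter> space (lborel \<Otimes>\<^sub>M lborel)
      = {l $ j<..<u $ j} \<times> ({l $ a<..<u $ a} \<times> {l $ b<..<u $ b})"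
    by (auto simp: face_in_box space_pair_measure)
  then have "emeasure (distr (lborel \<Otimes>\<^sub>M lborel) borel (\<lambda>(c, p). face j a c p)) (box l u)
      = emeasure (lborel \<Otimes>\<^sub>M (lborel \<Otimes>\<^sub>M lborel)) ({l $ j<..<u $ j} \<times> ({l $ a<..<u $ a} \<times> {l $ b<..<u $ b}))"
    using measurable_face by (subst emeasure_distr) (auto simp: lborel_prod)
  also have "\<dots> = ennreal (u $ j - l $ j) * (ennreal (u $ a - l $ a) * ennreal (u $ b - l $ b))"
  proof -
    have times: "emeasure lborel (A \<times> B) = emeasure lborel A * emeasure lborel B"
      if "A \<in> sets borel" "B \<in> sets borel"
      for A :: "'x::euclidean_space set" and B :: "'y::euclidean_space set"
      using that unfolding lborel_prod[symmetric] by (intro lborel.emeasure_pair_measure_Times) auto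
    have "{l $ a<..<u $ a} \<times> {l $ b<..<u $ b} \<in> sets borel"
      by (intro borel_open open_Times) auto
    then show ?thesis
      using le' by (simp add: lborel_prod times)
  qed
  also have "\<dots> = (\<Prod>i\<in>UNIV. u $ i - l $ i)"
    using distinct le' by (simp add: UNIV_axes ennreal_mult)
  also have "(\<Prod>i\<in>UNIV. u $ i - l $ i) = (\<Prod>b\<in>Basis. (u - l) \<bullet> b)"
  proof -
    have B: "(Basis :: (real^3) set) = (\<lambda>i. axis i 1) ` UNIV" by (auto simp: Basis_vec_def)
    have "(\<Prod>b\<in>Basis. (u - l) \<bullet> b) = (\<Prod>i\<in>UNIV. (u - l) \<bullet> axis i 1)"
      by (subst B, subst prod.reindex) (auto simp: inj_on_def axis_eq_axis)
    then show ?thesis by (simp add: inner_axis)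
  qed
  finally show "emeasure (distr (lborel \<Otimes>\<^sub>M lborel) borel (\<lambda>(c, p). face j a c p)) (box l u)
      = ennreal (\<Prod>b\<in>Basis. (u - l) \<bullet> b)" .
qed simp

lemma integral_cbox_face:
  fixes f :: "real^3 \<Rightarrow> real"
  assumes f: "continuous_on (cbox l u) f"
  shows "(LINT x|lebesgue_on (cbox l u). f x) =
     (LINT p|lebesgue_on ({l $ a..u $ a} \<times> {l $ b..u $ b}). LINT c|lebesgue_on {l $ j..u $ j}. f (face j a c p))"
proof -
  let ?P = "{l $ a..u $ a} \<times> {l $ b..u $ b}"
  define g where "g x = indicator (cbox l u) x *\<^sub>R f x" for x
  have gm[measurable]: "g \<in> borel_measurable borel"
    unfolding g_def using borel_measurable_continuous_on_indicator[OF _ f] by simp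
  have gi: "integrable lborel g"
    unfolding g_def using borel_integrable_compact[OF compact_cbox f] by (simp add: indicator_scaleR_eq_if)
  have P: "?P = cbox (l $ a, l $ b) (u $ a, u $ b)" by (simp add: cbox_Pair_eq)
  interpret lborel_pair: pair_sigma_finite "lborel :: real measure" "lborel :: (real \<times> real) measure" ..
  have "(LINT x|lebesgue_on (cbox l u). f x) = (LINT x|lebesgue. g x)"
    unfolding g_def by (subst integral_restrict_space) auto
  also have "\<dots> = (LINT x|lborel. g x)" by (rule integral_completion) simp
  also have "\<dots> = (LINT x|distr (lborel \<Otimes>\<^sub>M lborel) borel (\<lambda>(c, p). face j a c p). g x)"
    by (subst lborel_face) simp
  also have "\<dots> = (LINT q|(lborel \<Otimes>\<^sub>M lborel). g (case q of (c, p) \<Rightarrow> face j a c p))"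
    by (rule integral_distr) measurable
  also have "\<dots> = (LINT p|lborel. LINT c|lborel. g (face j a c p))"
  proof -
    have "integrable (distr (lborel \<Otimes>\<^sub>M lborel) borel (\<lambda>(c, p). face j a c p)) g"
      using gi by (subst lborel_face[symmetric])
    then have "integrable (lborel \<Otimes>\<^sub>M lborel) (\<lambda>q. g (case q of (c, p) \<Rightarrow> face j a c p))"
      by (subst (asm) integrable_distr_eq) measurable
    then show ?thesis
      using lborel_pair.integral_snd[of "\<lambda>c p. g (face j a c p)"] by (simp add: case_prod_beta')
  qed
  also have "\<dots> = (LINT p|lebesgue. LINT c|lborel. g (face j a c p))"
  proof (rule integral_completion[symmetric])
    have "(\<lambda>(p, c). g (face j a c p)) \<in> borel_measurable (lborel \<Otimes>\<^sub>M lborel)"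
      using measurable_compose[OF measurable_compose[OF measurable_pair_swap' measurable_face] gm]
      by (simp add: case_prod_beta')
    then show "(\<lambda>p. LINT c|lborel. g (face j a c p)) \<in> borel_measurable lborel"
      by (rule lborel.borel_measurable_lebesgue_integral)
  qed
  also have "\<dots> = (LINT p|lebesgue. indicator ?P p *\<^sub>R (LINT c|lebesgue_on {l $ j..u $ j}. f (face j a c p)))"
  proof (rule Bochner_Integration.integral_cong[OF refl])
    fix p :: "real \<times> real"
    have "(LINT c|lborel. g (face j a c p)) = (LINT c|lebesgue. g (face j a c p))"
      by (rule integral_completion[symmetric]) (use measurable_face in measurable)
    also have "\<dots> = (LINT c|lebesgue. indicator {l $ j..u $ j} c *\<^sub>R (indicator ?P p *\<^sub>R f (face j a c p)))"
      by (intro Bochner_Integration.integral_cong[OF refl]) (simp add: g_def indicator_def face_in_cbox)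
    also have "\<dots> = (LINT c|lebesgue_on {l $ j..u $ j}. indicator ?P p *\<^sub>R f (face j a c p))"
      by (subst integral_restrict_space) auto
    finally show "(LINT c|lborel. g (face j a c p))
        = indicator ?P p *\<^sub>R (LINT c|lebesgue_on {l $ j..u $ j}. f (face j a c p))" by simp
  qed
  also have "\<dots> = (LINT p|lebesgue_on ?P. LINT c|lebesgue_on {l $ j..u $ j}. f (face j a c p))"
    by (subst integral_restrict_space) (auto simp: P)
  finally show ?thesis .
qed

text \<open>The fundamental theorem of calculus on the lines parallel to the \<open>j\<close>-th axis.\<close>

lemma integral_partial_derivative:
  fixes f :: "real^3 \<Rightarrow> real"
  assumes le: "l $ j \<le> u $ j" and f: "continuous_on (cbox l u) f" and f': "continuous_on (cbox l u) f'"
    and deriv: "\<And>c p. face j a c p \<in> cbox l u \<Longrightarrow>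
       ((\<lambda>c. f (face j a c p)) has_real_derivative f' (face j a c p)) (at c within {l $ j..u $ j})"
  shows "(LINT x|lebesgue_on (cbox l u). f' x) =
     (LINT p|lebesgue_on ({l $ a..u $ a} \<times> {l $ b..u $ b}). f (face j a (u $ j) p))
     - (LINT p|lebesgue_on ({l $ a..u $ a} \<times> {l $ b..u $ b}). f (face j a (l $ j) p))"
proof -
  let ?P = "{l $ a..u $ a} \<times> {l $ b..u $ b}"
  have P: "?P = cbox (l $ a, l $ b) (u $ a, u $ b)" by (simp add: cbox_Pair_eq)
  have inner: "(LINT c|lebesgue_on {l $ j..u $ j}. f' (face j a c p))
      = f (face j a (u $ j) p) - f (face j a (l $ j) p)" if p: "p \<in> ?P" for p
  proof -
    have "((\<lambda>c. f' (face j a c p)) has_integral (f (face j a (u $ j) p) - f (face j a (l $ j) p))) {l $ j..u $ j}"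
      using le deriv p
      by (intro fundamental_theorem_of_calculus) (auto simp: face_in_cbox has_real_derivative_iff_has_vector_derivative)
    moreover have "continuous_on {l $ j..u $ j} (\<lambda>c. f' (face j a c p))"
      using p by (intro continuous_on_compose2[OF f'] continuous_on_face) (auto simp: face_in_cbox intro: continuous_intros)
    then have "(\<lambda>c. f' (face j a c p)) absolutely_integrable_on {l $ j..u $ j}"
      by (metis absolutely_integrable_continuous cbox_interval)
    ultimately show ?thesis
      by (metis (no_types, lifting) absolutely_integrable_imp_integrable has_integral_integral_lebesgue_on
          has_integral_unique lmeasurable_cbox cbox_interval fmeasurableD)
  qed
  have int: "integrable (lebesgue_on ?P) (\<lambda>p. f (face j a c p))" if "c \<in> {l $ j..u $ j}" for c
  proof -
    have "continuous_on ?P (\<lambda>p. f (face j a c p))"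
      using that by (intro continuous_on_compose2[OF f] continuous_on_face) (auto simp: face_in_cbox intro: continuous_intros)
    then have "(\<lambda>p. f (face j a c p)) absolutely_integrable_on ?P"
      unfolding P by (rule absolutely_integrable_continuous)
    then show ?thesis
      by (intro absolutely_integrable_imp_integrable) (auto simp: P)
  qed
  have "(LINT x|lebesgue_on (cbox l u). f' x)
      = (LINT p|lebesgue_on ?P. f (face j a (u $ j) p) - f (face j a (l $ j) p))"
    unfolding integral_cbox_face[OF f'] by (intro Bochner_Integration.integral_cong refl) (simp add: inner)
  also have "\<dots> = (LINT p|lebesgue_on ?P. f (face j a (u $ j) p)) - (LINT p|lebesgue_on ?P. f (face j a (l $ j) p))"
    using le by (intro Bochner_Integration.integral_diff int) auto
  finally show ?thesis .
qed

end

section \<open>Limits of products in L2\<close>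

lemma in_L2_mult_integrable:
  fixes f g :: "'a::euclidean_space \<Rightarrow> real"
  assumes "in_L2 S f" "in_L2 S g"
  shows "integrable (lebesgue_on S) (\<lambda>x. f x * g x)"
proof (rule Bochner_Integration.integrable_bound)
  show "integrable (lebesgue_on S) (\<lambda>x. (f x)\<^sup>2 + (g x)\<^sup>2)"
    using assms by (auto simp: in_L2_def)
  show "(\<lambda>x. f x * g x) \<in> borel_measurable (lebesgue_on S)"
    using assms by (auto simp: in_L2_def)
  show "AE x in lebesgue_on S. norm (f x * g x) \<le> norm ((f x)\<^sup>2 + (g x)\<^sup>2)"
  proof (rule AE_I2)
    fix x
    have "2 * (\<bar>f x\<bar> * \<bar>g x\<bar>) \<le> \<bar>f x\<bar>\<^sup>2 + \<bar>g x\<bar>\<^sup>2"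
      using sum_squares_bound[of "\<bar>f x\<bar>" "\<bar>g x\<bar>"] by simp
    moreover have "0 \<le> \<bar>f x\<bar> * \<bar>g x\<bar>" by simp
    ultimately show "norm (f x * g x) \<le> norm ((f x)\<^sup>2 + (g x)\<^sup>2)"
      unfolding real_norm_def abs_mult power2_abs by linarith
  qed
qed

lemma in_L2_add:
  fixes f g :: "'a::euclidean_space \<Rightarrow> real"
  assumes "in_L2 S f" "in_L2 S g"
  shows "in_L2 S (\<lambda>x. f x + g x)"
proof -
  have "integrable (lebesgue_on S) (\<lambda>x. (f x)\<^sup>2 + (g x)\<^sup>2 + 2 * (f x * g x))"
    using assms in_L2_mult_integrable[OF assms] by (auto simp: in_L2_def)
  then show ?thesis
    using assms by (auto simp: in_L2_def power2_sum mult.assoc)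
qed

lemma in_L2_bounded_mult:
  fixes f h :: "'a::euclidean_space \<Rightarrow> real"
  assumes f: "in_L2 S f" and h: "h \<in> borel_measurable (lebesgue_on S)"
    and B: "\<And>x. x \<in> S \<Longrightarrow> \<bar>h x\<bar> \<le> B"
  shows "in_L2 S (\<lambda>x. h x * f x)"
proof -
  have fm[measurable]: "f \<in> borel_measurable (lebesgue_on S)" using f by (simp add: in_L2_def)
  note h[measurable]
  have "integrable (lebesgue_on S) (\<lambda>x. (norm (h x * f x))\<^sup>2)"
  proof (rule Bochner_Integration.integrable_bound)
    show "integrable (lebesgue_on S) (\<lambda>x. B\<^sup>2 * (f x)\<^sup>2)" using f by (auto simp: in_L2_def)
    show "(\<lambda>x. (norm (h x * f x))\<^sup>2) \<in> borel_measurable (lebesgue_on S)" by measurable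
    show "AE x in lebesgue_on S. norm ((norm (h x * f x))\<^sup>2) \<le> norm (B\<^sup>2 * (f x)\<^sup>2)"
    proof (rule AE_I2)
      fix x assume "x \<in> space (lebesgue_on S)"
      then have "(h x)\<^sup>2 \<le> B\<^sup>2" using B[of x] by (auto intro: abs_le_square_iff[THEN iffD1])
      then show "norm ((norm (h x * f x))\<^sup>2) \<le> norm (B\<^sup>2 * (f x)\<^sup>2)"
        by (simp add: power_mult_distrib mult_right_mono)
    qed
  qed
  then show ?thesis by (simp add: in_L2_def)
qed

lemma in_L2_diff:
  fixes f g :: "'a::euclidean_space \<Rightarrow> real"
  assumes "in_L2 S f" "in_L2 S g"
  shows "in_L2 S (\<lambda>x. f x - g x)"
  using in_L2_add[OF assms(1) in_L2_bounded_mult[OF assms(2), of "\<lambda>_. -1" 1]] by simp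

lemma in_L2_continuous_on:
  fixes f :: "'a::euclidean_space \<Rightarrow> 'b::euclidean_space"
  assumes "compact S" "continuous_on S f"
  shows "in_L2 S f"
proof -
  have S: "S \<in> sets lebesgue" using assms(1) by (simp add: lmeasurable_compact fmeasurableD)
  have "continuous_on S (\<lambda>x. (norm (f x))\<^sup>2)" using assms(2) by (intro continuous_intros)
  then have int: "integrable lborel (\<lambda>x. indicator S x *\<^sub>R (norm (f x))\<^sup>2)"
    by (rule borel_integrable_compact[OF assms(1)])
  then have "integrable lebesgue (\<lambda>x. indicator S x *\<^sub>R (norm (f x))\<^sup>2)"
    using integrable_completion borel_measurable_integrable by blast
  then have "integrable (lebesgue_on S) (\<lambda>x. (norm (f x))\<^sup>2)"
    using S by (subst integrable_restrict_space) auto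
  then show ?thesis
    using assms S by (simp add: in_L2_def continuous_imp_measurable_on_sets_lebesgue)
qed

lemma L2_tendsto_const: "in_L2 S f \<Longrightarrow> L2_tendsto S (\<lambda>k. f) f"
  by (simp add: L2_tendsto_def)

text \<open>The quadratic function that maps \<open>s\<close> to the integral of \<open>(s f - g)^2\<close> is nonnegative, so its
  discriminant is not positive.\<close>

lemma integral_mult_Cauchy_Schwarz:
  fixes f g :: "'a::euclidean_space \<Rightarrow> real"
  assumes f: "in_L2 S f" and g: "in_L2 S g"
  shows "\<bar>LINT x|lebesgue_on S. f x * g x\<bar>
      \<le> sqrt (LINT x|lebesgue_on S. (f x)\<^sup>2) * sqrt (LINT x|lebesgue_on S. (g x)\<^sup>2)"
proof -
  define A B C where "A = (LINT x|lebesgue_on S. (f x)\<^sup>2)" "B = (LINT x|lebesgue_on S. (g x)\<^sup>2)"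
    "C = (LINT x|lebesgue_on S. f x * g x)"
  have int: "integrable (lebesgue_on S) (\<lambda>x. (f x)\<^sup>2)" "integrable (lebesgue_on S) (\<lambda>x. (g x)\<^sup>2)"
    using f g by (auto simp: in_L2_def)
  have q: "0 \<le> s\<^sup>2 * A - 2 * s * C + B" for s
  proof -
    have "0 \<le> (LINT x|lebesgue_on S. s\<^sup>2 * (f x)\<^sup>2 - 2 * s * (f x * g x) + (g x)\<^sup>2)"
    proof (rule integral_nonneg_AE, rule AE_I2)
      fix x
      have "s\<^sup>2 * (f x)\<^sup>2 - 2 * s * (f x * g x) + (g x)\<^sup>2 = (s * f x - g x)\<^sup>2"
        by (simp add: power2_eq_square algebra_simps)
      then show "0 \<le> s\<^sup>2 * (f x)\<^sup>2 - 2 * s * (f x * g x) + (g x)\<^sup>2" by simp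
    qed
    also have "\<dots> = s\<^sup>2 * A - 2 * s * C + B"
      using int in_L2_mult_integrable[OF f g] by (simp add: A_B_C_def)
    finally show ?thesis .
  qed
  have A: "0 \<le> A" by (simp add: A_B_C_def)
  have "C\<^sup>2 \<le> A * B"
  proof (cases "A = 0")
    case True
    \<comment> \<open>At this \<open>s\<close> the quadratic, then affine, function would take the value \<open>-1\<close>.\<close>
    have "C = 0"
      using q[of "(B + 1) / (2 * C)"] True by (cases "C = 0") auto
    then show ?thesis using True by simp
  next
    case False
    have "0 \<le> (C / A)\<^sup>2 * A - 2 * (C / A) * C + B" by (rule q)
    also have "\<dots> = B - C\<^sup>2 / A" using False by (simp add: field_simps power2_eq_square)
    finally show ?thesis using False A by (simp add: field_simps)
  qed
  then show ?thesis
    unfolding A_B_C_def[symmetric] real_sqrt_mult[symmetric] by (rule real_le_rsqrt[of "\<bar>C\<bar>", simplified])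
qed

lemma L2_tendsto_diff_0:
  fixes f :: "'a::euclidean_space \<Rightarrow> real"
  assumes "L2_tendsto S F f" "in_L2 S h"
  shows "(\<lambda>k. LINT x|lebesgue_on S. (F k x - f x) * h x) \<longlonglongrightarrow> 0"
proof (rule Lim_null_comparison)
  have d: "in_L2 S (\<lambda>x. F k x - f x)" for k
    using assms(1) by (intro in_L2_diff) (auto simp: L2_tendsto_def)
  show "\<forall>\<^sub>F k in sequentially. norm (LINT x|lebesgue_on S. (F k x - f x) * h x)
      \<le> sqrt (LINT x|lebesgue_on S. (norm (F k x - f x))\<^sup>2) * sqrt (LINT x|lebesgue_on S. (h x)\<^sup>2)"
    using integral_mult_Cauchy_Schwarz[OF d assms(2)] by (intro always_eventually) auto
  have "(\<lambda>k. sqrt (LINT x|lebesgue_on S. (norm (F k x - f x))\<^sup>2) * sqrt (LINT x|lebesgue_on S. (h x)\<^sup>2))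
      \<longlonglongrightarrow> sqrt 0 * sqrt (LINT x|lebesgue_on S. (h x)\<^sup>2)"
    using assms(1) by (intro tendsto_intros) (auto simp: L2_tendsto_def)
  then show "(\<lambda>k. sqrt (LINT x|lebesgue_on S. (norm (F k x - f x))\<^sup>2) * sqrt (LINT x|lebesgue_on S. (h x)\<^sup>2))
      \<longlonglongrightarrow> 0" by simp
qed

text \<open>By Cauchy-Schwarz, each term of \<open>F H - f h = (F - f) (H - h) + (F - f) h + (H - h) f\<close> has an
  integral tending to zero.\<close>

lemma L2_tendsto_integral_mult:
  fixes f h :: "'a::euclidean_space \<Rightarrow> real"
  assumes F: "L2_tendsto S F f" and H: "L2_tendsto S H h"
  shows "(\<lambda>k. LINT x|lebesgue_on S. F k x * H k x) \<longlonglongrightarrow> (LINT x|lebesgue_on S. f x * h x)"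
proof -
  have L2: "in_L2 S (F k)" "in_L2 S (H k)" "in_L2 S f" "in_L2 S h" for k
    using F H by (auto simp: L2_tendsto_def)
  have d: "in_L2 S (\<lambda>x. F k x - f x)" "in_L2 S (\<lambda>x. H k x - h x)" for k
    by (intro in_L2_diff L2)+
  have "(\<lambda>k. LINT x|lebesgue_on S. (F k x - f x) * (H k x - h x)) \<longlonglongrightarrow> 0"
  proof (rule Lim_null_comparison)
    show "\<forall>\<^sub>F k in sequentially. norm (LINT x|lebesgue_on S. (F k x - f x) * (H k x - h x))
        \<le> sqrt (LINT x|lebesgue_on S. (norm (F k x - f x))\<^sup>2) * sqrt (LINT x|lebesgue_on S. (norm (H k x - h x))\<^sup>2)"
      using integral_mult_Cauchy_Schwarz[OF d] by (intro always_eventually) auto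
    have "(\<lambda>k. sqrt (LINT x|lebesgue_on S. (norm (F k x - f x))\<^sup>2) * sqrt (LINT x|lebesgue_on S. (norm (H k x - h x))\<^sup>2))
        \<longlonglongrightarrow> sqrt 0 * sqrt 0"
      using F H by (intro tendsto_intros) (auto simp: L2_tendsto_def)
    then show "(\<lambda>k. sqrt (LINT x|lebesgue_on S. (norm (F k x - f x))\<^sup>2) * sqrt (LINT x|lebesgue_on S. (norm (H k x - h x))\<^sup>2))
        \<longlonglongrightarrow> 0" by simp
  qed
  from tendsto_add[OF tendsto_add[OF tendsto_add[OF this L2_tendsto_diff_0[OF F L2(4)]]
      L2_tendsto_diff_0[OF H L2(3)]] tendsto_const[of "LINT x|lebesgue_on S. f x * h x"]]
  have "(\<lambda>k. (LINT x|lebesgue_on S. (F k x - f x) * (H k x - h x)) + (LINT x|lebesgue_on S. (F k x - f x) * h x)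
      + (LINT x|lebesgue_on S. (H k x - h x) * f x) + (LINT x|lebesgue_on S. f x * h x))
      \<longlonglongrightarrow> (LINT x|lebesgue_on S. f x * h x)" by simp
  moreover have "(LINT x|lebesgue_on S. (F k x - f x) * (H k x - h x)) + (LINT x|lebesgue_on S. (F k x - f x) * h x)
      + (LINT x|lebesgue_on S. (H k x - h x) * f x) + (LINT x|lebesgue_on S. f x * h x)
      = (LINT x|lebesgue_on S. F k x * H k x)" for k
  proof -
    note int = in_L2_mult_integrable[OF d] in_L2_mult_integrable[OF d(1) L2(4)]
      in_L2_mult_integrable[OF d(2) L2(3)] in_L2_mult_integrable[OF L2(3) L2(4)]
    have "F k x * H k x = (F k x - f x) * (H k x - h x) + (F k x - f x) * h x + (H k x - h x) * f x + f x * h x" for x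
      by (simp add: algebra_simps)
    then show ?thesis
      using int by simp
  qed
  ultimately show ?thesis by simp
qed

lemma L2_tendsto_add:
  fixes f h :: "'a::euclidean_space \<Rightarrow> real"
  assumes F: "L2_tendsto S F f" and H: "L2_tendsto S H h"
  shows "L2_tendsto S (\<lambda>k x. F k x + H k x) (\<lambda>x. f x + h x)"
proof -
  have L2: "in_L2 S (F k)" "in_L2 S (H k)" "in_L2 S f" "in_L2 S h" for k
    using F H by (auto simp: L2_tendsto_def)
  have d: "in_L2 S (\<lambda>x. F k x - f x)" "in_L2 S (\<lambda>x. H k x - h x)" for k
    by (intro in_L2_diff L2)+
  have int: "integrable (lebesgue_on S) (\<lambda>x. (F k x - f x)\<^sup>2)" "integrable (lebesgue_on S) (\<lambda>x. (H k x - h x)\<^sup>2)" for k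
    using d by (auto simp: in_L2_def)
  have "(\<lambda>k. LINT x|lebesgue_on S. (norm (F k x + H k x - (f x + h x)))\<^sup>2) \<longlonglongrightarrow> 0"
  proof (rule Lim_null_comparison)
    have "norm (LINT x|lebesgue_on S. (norm (F k x + H k x - (f x + h x)))\<^sup>2)
        \<le> 2 * (LINT x|lebesgue_on S. (norm (F k x - f x))\<^sup>2) + 2 * (LINT x|lebesgue_on S. (norm (H k x - h x))\<^sup>2)" for k
    proof -
      have "(LINT x|lebesgue_on S. (norm (F k x + H k x - (f x + h x)))\<^sup>2)
          \<le> (LINT x|lebesgue_on S. 2 * (F k x - f x)\<^sup>2 + 2 * (H k x - h x)\<^sup>2)"
      proof (rule integral_mono)
        show "integrable (lebesgue_on S) (\<lambda>x. (norm (F k x + H k x - (f x + h x)))\<^sup>2)"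
          using in_L2_diff[OF in_L2_add[OF L2(1,2)] in_L2_add[OF L2(3,4)]] by (simp add: in_L2_def)
        show "integrable (lebesgue_on S) (\<lambda>x. 2 * (F k x - f x)\<^sup>2 + 2 * (H k x - h x)\<^sup>2)" using int by simp
        fix x
        show "(norm (F k x + H k x - (f x + h x)))\<^sup>2 \<le> 2 * (F k x - f x)\<^sup>2 + 2 * (H k x - h x)\<^sup>2"
          using sum_squares_bound[of "F k x - f x" "H k x - h x"]
          by (simp add: power2_eq_square algebra_simps)
      qed
      then show ?thesis using int by simp
    qed
    then show "\<forall>\<^sub>F k in sequentially. norm (LINT x|lebesgue_on S. (norm (F k x + H k x - (f x + h x)))\<^sup>2)
        \<le> 2 * (LINT x|lebesgue_on S. (norm (F k x - f x))\<^sup>2) + 2 * (LINT x|lebesgue_on S. (norm (H k x - h x))\<^sup>2)"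
      by simp
    have "(\<lambda>k. 2 * (LINT x|lebesgue_on S. (norm (F k x - f x))\<^sup>2) + 2 * (LINT x|lebesgue_on S. (norm (H k x - h x))\<^sup>2))
        \<longlonglongrightarrow> 2 * 0 + 2 * 0"
      using F H by (intro tendsto_intros) (auto simp: L2_tendsto_def)
    then show "(\<lambda>k. 2 * (LINT x|lebesgue_on S. (norm (F k x - f x))\<^sup>2) + 2 * (LINT x|lebesgue_on S. (norm (H k x - h x))\<^sup>2))
        \<longlonglongrightarrow> 0" by simp
  qed
  then show ?thesis using L2 by (auto simp: L2_tendsto_def intro: in_L2_add)
qed

text \<open>Only differences are compared, which covers components of vector fields as well as products
  with a bounded function.\<close>

lemma L2_tendsto_dominated:
  fixes F :: "nat \<Rightarrow> 'a::euclidean_space \<Rightarrow> 'b::euclidean_space" and F' :: "nat \<Rightarrow> 'a \<Rightarrow> real"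
  assumes F: "L2_tendsto S F f" and F': "\<And>k. in_L2 S (F' k)" and f': "in_L2 S f'"
    and dom: "\<And>k x. x \<in> S \<Longrightarrow> \<bar>F' k x - f' x\<bar> \<le> B * norm (F k x - f x)"
  shows "L2_tendsto S F' f'"
proof -
  have "(\<lambda>k. LINT x|lebesgue_on S. (norm (F' k x - f' x))\<^sup>2) \<longlonglongrightarrow> 0"
  proof (rule Lim_null_comparison)
    have "norm (LINT x|lebesgue_on S. (norm (F' k x - f' x))\<^sup>2)
        \<le> B\<^sup>2 * (LINT x|lebesgue_on S. (norm (F k x - f x))\<^sup>2)" for k
    proof -
      have L2: "in_L2 S (F k)" "in_L2 S f" using F by (auto simp: L2_tendsto_def)
      have int: "integrable (lebesgue_on S) (\<lambda>x. (norm (F k x - f x))\<^sup>2)"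
      proof (rule Bochner_Integration.integrable_bound)
        show "integrable (lebesgue_on S) (\<lambda>x. 2 * (norm (F k x))\<^sup>2 + 2 * (norm (f x))\<^sup>2)"
          using L2 by (auto simp: in_L2_def)
        show "(\<lambda>x. (norm (F k x - f x))\<^sup>2) \<in> borel_measurable (lebesgue_on S)"
          using L2 by (auto simp: in_L2_def)
        have "(norm (F k x - f x))\<^sup>2 \<le> 2 * (norm (F k x))\<^sup>2 + 2 * (norm (f x))\<^sup>2" for x
        proof -
          have "(norm (F k x - f x))\<^sup>2 \<le> (norm (F k x) + norm (f x))\<^sup>2"
            by (intro power_mono norm_triangle_ineq4 norm_ge_zero)
          also have "\<dots> \<le> 2 * (norm (F k x))\<^sup>2 + 2 * (norm (f x))\<^sup>2"
            using sum_squares_bound[of "norm (F k x)" "norm (f x)"] by (simp add: power2_sum)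
          finally show ?thesis .
        qed
        then show "AE x in lebesgue_on S. norm ((norm (F k x - f x))\<^sup>2) \<le> norm (2 * (norm (F k x))\<^sup>2 + 2 * (norm (f x))\<^sup>2)"
          by simp
      qed
      have "(LINT x|lebesgue_on S. (norm (F' k x - f' x))\<^sup>2)
          \<le> (LINT x|lebesgue_on S. B\<^sup>2 * (norm (F k x - f x))\<^sup>2)"
      proof (rule integral_mono)
        show "integrable (lebesgue_on S) (\<lambda>x. (norm (F' k x - f' x))\<^sup>2)"
          using in_L2_diff[OF F' f'] by (simp add: in_L2_def)
        show "integrable (lebesgue_on S) (\<lambda>x. B\<^sup>2 * (norm (F k x - f x))\<^sup>2)" using int by simp
        fix x assume "x \<in> space (lebesgue_on S)"
        then have "\<bar>F' k x - f' x\<bar> \<le> B * norm (F k x - f x)" using dom by simp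
        then have "\<bar>F' k x - f' x\<bar>\<^sup>2 \<le> (B * norm (F k x - f x))\<^sup>2" by (intro power_mono) auto
        then show "(norm (F' k x - f' x))\<^sup>2 \<le> B\<^sup>2 * (norm (F k x - f x))\<^sup>2"
          by (simp add: power_mult_distrib)
      qed
      then show ?thesis by simp
    qed
    then show "\<forall>\<^sub>F k in sequentially. norm (LINT x|lebesgue_on S. (norm (F' k x - f' x))\<^sup>2)
        \<le> B\<^sup>2 * (LINT x|lebesgue_on S. (norm (F k x - f x))\<^sup>2)" by simp
    have "(\<lambda>k. B\<^sup>2 * (LINT x|lebesgue_on S. (norm (F k x - f x))\<^sup>2)) \<longlonglongrightarrow> B\<^sup>2 * 0"
      using F by (intro tendsto_intros) (auto simp: L2_tendsto_def)
    then show "(\<lambda>k. B\<^sup>2 * (LINT x|lebesgue_on S. (norm (F k x - f x))\<^sup>2)) \<longlonglongrightarrow> 0" by simp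
  qed
  then show ?thesis using F' f' by (simp add: L2_tendsto_def)
qed

lemma L2_tendsto_bounded_mult:
  fixes f h :: "'a::euclidean_space \<Rightarrow> real"
  assumes F: "L2_tendsto S F f" and h: "h \<in> borel_measurable (lebesgue_on S)"
    and B: "\<And>x. x \<in> S \<Longrightarrow> \<bar>h x\<bar> \<le> B"
  shows "L2_tendsto S (\<lambda>k x. h x * F k x) (\<lambda>x. h x * f x)"
proof (rule L2_tendsto_dominated[OF F])
  show "\<bar>h x * F k x - h x * f x\<bar> \<le> B * norm (F k x - f x)" if "x \<in> S" for k x
    using mult_right_mono[OF B[OF that], of "\<bar>F k x - f x\<bar>"]
    by (simp add: abs_mult flip: right_diff_distrib)
qed (use F in \<open>auto simp: L2_tendsto_def intro!: in_L2_bounded_mult[OF _ h B]\<close>)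

lemma in_L2_nth:
  fixes f :: "'a::euclidean_space \<Rightarrow> 'b::euclidean_space^'n"
  assumes f: "in_L2 S f"
  shows "in_L2 S (\<lambda>x. f x $ i)"
proof -
  have fm: "f \<in> borel_measurable (lebesgue_on S)" using f by (simp add: in_L2_def)
  have m: "(\<lambda>x. f x $ i) \<in> borel_measurable (lebesgue_on S)"
    by (rule measurable_compose[OF fm borel_measurable_continuous_onI]) (intro continuous_intros)
  have "integrable (lebesgue_on S) (\<lambda>x. (norm (f x $ i))\<^sup>2)"
  proof (rule Bochner_Integration.integrable_bound)
    show "integrable (lebesgue_on S) (\<lambda>x. (norm (f x))\<^sup>2)" using f by (simp add: in_L2_def)
    show "(\<lambda>x. (norm (f x $ i))\<^sup>2) \<in> borel_measurable (lebesgue_on S)" using m by measurable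
    show "AE x in lebesgue_on S. norm ((norm (f x $ i))\<^sup>2) \<le> norm ((norm (f x))\<^sup>2)"
      by (intro AE_I2) (simp add: Finite_Cartesian_Product.norm_nth_le)
  qed
  with m show ?thesis by (simp add: in_L2_def)
qed

lemma L2_tendsto_nth:
  fixes f :: "'a::euclidean_space \<Rightarrow> real^'n"
  assumes "L2_tendsto S F f"
  shows "L2_tendsto S (\<lambda>k x. F k x $ i) (\<lambda>x. f x $ i)"
proof (rule L2_tendsto_dominated[OF assms, where B = 1])
  show "\<bar>F k x $ i - f x $ i\<bar> \<le> 1 * norm (F k x - f x)" for k x
    using component_le_norm_cart[of "F k x - f x" i] by simp
qed (use assms in \<open>auto simp: L2_tendsto_def intro!: in_L2_nth\<close>)

lemma L2_tendsto_entry: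
  fixes f :: "'a::euclidean_space \<Rightarrow> real^'n^'m"
  assumes "L2_tendsto S F f"
  shows "L2_tendsto S (\<lambda>k x. F k x $ i $ j) (\<lambda>x. f x $ i $ j)"
proof (rule L2_tendsto_dominated[OF assms, where B = 1])
  show "\<bar>F k x $ i $ j - f x $ i $ j\<bar> \<le> 1 * norm (F k x - f x)" for k x
    using order_trans[OF component_le_norm_cart[of "(F k x - f x) $ i" j] Finite_Cartesian_Product.norm_nth_le[of "F k x - f x" i]]
    by simp
qed (use assms in \<open>auto simp: L2_tendsto_def intro!: in_L2_nth\<close>)

section \<open>Integration by parts with traces\<close>

lemma smooth_imp_differentiable: "smooth v \<Longrightarrow> v differentiable (at x)"
  unfolding smooth_def by (metis C_k.simps(2))

lemma smooth_imp_continuous_on: "smooth v \<Longrightarrow> continuous_on S v"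
  unfolding smooth_def by (metis C_k.simps(1) continuous_on_subset subset_UNIV)

lemma jacobian_nth: "jacobian v (at x) $ i $ j = frechet_derivative v (at x) (axis j 1) $ i"
  by (simp add: jacobian_def matrix_def)

lemma smooth_imp_continuous_on_partial:
  assumes "smooth v"
  shows "continuous_on S (\<lambda>x. frechet_derivative v (at x) (axis j 1))"
proof -
  have "C_k (Suc 0) v" using assms unfolding smooth_def by blast
  then show ?thesis by (auto intro: continuous_on_subset[of UNIV])
qed

lemma smooth_imp_continuous_on_jacobian:
  assumes "smooth v"
  shows "continuous_on S (\<lambda>x. jacobian v (at x) $ i $ j)"
  unfolding jacobian_nth using smooth_imp_continuous_on_partial[OF assms, of S j]
  by (intro continuous_intros)

context axes
begin

lemma has_derivative_face: "((\<lambda>c. face j a c p) has_derivative (\<lambda>h. h *\<^sub>R axis j 1)) (at c within S)"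
proof -
  have "face j a c p = face j a 0 p + c *\<^sub>R axis j 1" for c
    using distinct by (auto simp: face_def vec_eq_iff axis_def)
  then have "(\<lambda>c. face j a c p) = (\<lambda>c. face j a 0 p + c *\<^sub>R axis j 1)" by blast
  then show ?thesis by (auto intro!: derivative_eq_intros)
qed

lemma smooth_partial_on_face:
  fixes v :: "real^3 \<Rightarrow> 'b::real_normed_vector"
  assumes "smooth v"
  shows "((\<lambda>c. v (face j a c p)) has_vector_derivative frechet_derivative v (at (face j a c p)) (axis j 1)) (at c within S)"
proof -
  let ?D = "frechet_derivative v (at (face j a c p))"
  have D: "(v has_derivative ?D) (at (face j a c p))"
    using smooth_imp_differentiable[OF assms] by (simp add: frechet_derivative_works)
  have "((\<lambda>c. v (face j a c p)) has_derivative (\<lambda>h. ?D (h *\<^sub>R axis j 1))) (at c within S)"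
    by (rule has_derivative_compose[OF has_derivative_face D])
  moreover have "?D (h *\<^sub>R axis j 1) = h *\<^sub>R ?D (axis j 1)" for h
    using linear_scale[OF has_derivative_linear[OF D]] .
  ultimately show ?thesis by (simp add: has_vector_derivative_def)
qed

lemma smooth_component_partial_on_face:
  fixes v :: "real^3 \<Rightarrow> real^'m"
  assumes "smooth v"
  shows "((\<lambda>c. v (face j a c p) $ i) has_real_derivative jacobian v (at (face j a c p)) $ i $ j) (at c within S)"
  unfolding has_real_derivative_iff_has_vector_derivative jacobian_nth
  by (rule bounded_linear.has_vector_derivative[OF bounded_linear_vec_nth smooth_partial_on_face[OF assms]])

text \<open>A scalar field \<open>f\<close> with \<open>j\<close>-th partial derivative \<open>Df\<close> and values \<open>gl\<close>, \<open>gu\<close> on the two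
  faces orthogonal to the \<open>j\<close>-th axis, all of them as limits in L2. This is all that is needed to
  integrate by parts in the \<open>j\<close>-th direction.\<close>

definition has_face_traces ::
    "real^3 \<Rightarrow> real^3 \<Rightarrow> (real^3 \<Rightarrow> real) \<Rightarrow> (real^3 \<Rightarrow> real) \<Rightarrow> (real \<times> real \<Rightarrow> real) \<Rightarrow> (real \<times> real \<Rightarrow> real) \<Rightarrow> bool"
  where "has_face_traces l u f Df gl gu \<longleftrightarrow> (\<exists>F F'.
     (\<forall>k. continuous_on (cbox l u) (F k) \<and> continuous_on (cbox l u) (F' k) \<and>
        (\<forall>c p. face j a c p \<in> cbox l u \<longrightarrow>
          ((\<lambda>c. F k (face j a c p)) has_real_derivative F' k (face j a c p)) (at c within {l $ j..u $ j}))) \<and>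
     L2_tendsto (cbox l u) F f \<and> L2_tendsto (cbox l u) F' Df \<and>
     L2_tendsto ({l $ a..u $ a} \<times> {l $ b..u $ b}) (\<lambda>k p. F k (face j a (l $ j) p)) gl \<and>
     L2_tendsto ({l $ a..u $ a} \<times> {l $ b..u $ b}) (\<lambda>k p. F k (face j a (u $ j) p)) gu)"

text \<open>The divergence theorem holds for the products of the approximations, and all four integrals
  involved are of products of two sequences that converge in L2.\<close>

lemma integration_by_parts:
  assumes f: "has_face_traces l u f Df fl fu" and h: "has_face_traces l u h Dh hl hu"
    and le: "l $ j \<le> u $ j"
  shows "(LINT x|lebesgue_on (cbox l u). Df x * h x + f x * Dh x) =
     (LINT p|lebesgue_on ({l $ a..u $ a} \<times> {l $ b..u $ b}). fu p * hu p)
     - (LINT p|lebesgue_on ({l $ a..u $ a} \<times> {l $ b..u $ b}). fl p * hl p)"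
proof -
  let ?P = "{l $ a..u $ a} \<times> {l $ b..u $ b}"
  obtain F F' where F: "\<And>k. continuous_on (cbox l u) (F k)" "\<And>k. continuous_on (cbox l u) (F' k)"
      "\<And>k c p. face j a c p \<in> cbox l u \<Longrightarrow>
         ((\<lambda>c. F k (face j a c p)) has_real_derivative F' k (face j a c p)) (at c within {l $ j..u $ j})"
      "L2_tendsto (cbox l u) F f" "L2_tendsto (cbox l u) F' Df"
      "L2_tendsto ?P (\<lambda>k p. F k (face j a (l $ j) p)) fl" "L2_tendsto ?P (\<lambda>k p. F k (face j a (u $ j) p)) fu"
    using f unfolding has_face_traces_def by blast
  obtain H H' where H: "\<And>k. continuous_on (cbox l u) (H k)" "\<And>k. continuous_on (cbox l u) (H' k)"
      "\<And>k c p. face j a c p \<in> cbox l u \<Longrightarrow>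
         ((\<lambda>c. H k (face j a c p)) has_real_derivative H' k (face j a c p)) (at c within {l $ j..u $ j})"
      "L2_tendsto (cbox l u) H h" "L2_tendsto (cbox l u) H' Dh"
      "L2_tendsto ?P (\<lambda>k p. H k (face j a (l $ j) p)) hl" "L2_tendsto ?P (\<lambda>k p. H k (face j a (u $ j) p)) hu"
    using h unfolding has_face_traces_def by blast
  have int: "integrable (lebesgue_on (cbox l u)) (\<lambda>x. F' k x * H k x)"
    "integrable (lebesgue_on (cbox l u)) (\<lambda>x. F k x * H' k x)" for k
    using F(4,5) H(4,5) by (auto intro!: in_L2_mult_integrable simp: L2_tendsto_def)
  have int': "integrable (lebesgue_on (cbox l u)) (\<lambda>x. Df x * h x)"
    "integrable (lebesgue_on (cbox l u)) (\<lambda>x. f x * Dh x)"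
    using F(4,5) H(4,5) by (auto intro!: in_L2_mult_integrable simp: L2_tendsto_def)
  have "(LINT x|lebesgue_on (cbox l u). F' k x * H k x) + (LINT x|lebesgue_on (cbox l u). F k x * H' k x) =
      (LINT p|lebesgue_on ?P. F k (face j a (u $ j) p) * H k (face j a (u $ j) p))
      - (LINT p|lebesgue_on ?P. F k (face j a (l $ j) p) * H k (face j a (l $ j) p))" for k
  proof -
    have "(LINT x|lebesgue_on (cbox l u). F' k x * H k x) + (LINT x|lebesgue_on (cbox l u). F k x * H' k x)
        = (LINT x|lebesgue_on (cbox l u). F' k x * H k x + F k x * H' k x)"
      using int by simp
    also have "\<dots> = (LINT p|lebesgue_on ?P. F k (face j a (u $ j) p) * H k (face j a (u $ j) p))
      - (LINT p|lebesgue_on ?P. F k (face j a (l $ j) p) * H k (face j a (l $ j) p))"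
    proof (rule integral_partial_derivative[where f = "\<lambda>x. F k x * H k x"])
      show "((\<lambda>c. F k (face j a c p) * H k (face j a c p)) has_real_derivative
          F' k (face j a c p) * H k (face j a c p) + F k (face j a c p) * H' k (face j a c p))
          (at c within {l $ j..u $ j})" if "face j a c p \<in> cbox l u" for c p
        using DERIV_mult'[OF F(3)[OF that] H(3)[OF that]] by (simp add: add.commute)
    qed (intro le continuous_intros F H)+
    finally show ?thesis .
  qed
  moreover have "(\<lambda>k. (LINT x|lebesgue_on (cbox l u). F' k x * H k x) + (LINT x|lebesgue_on (cbox l u). F k x * H' k x))
      \<longlonglongrightarrow> (LINT x|lebesgue_on (cbox l u). Df x * h x) + (LINT x|lebesgue_on (cbox l u). f x * Dh x)"
    by (intro tendsto_add L2_tendsto_integral_mult F H)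
  moreover have "(\<lambda>k. (LINT p|lebesgue_on ?P. F k (face j a (u $ j) p) * H k (face j a (u $ j) p))
      - (LINT p|lebesgue_on ?P. F k (face j a (l $ j) p) * H k (face j a (l $ j) p)))
      \<longlonglongrightarrow> (LINT p|lebesgue_on ?P. fu p * hu p) - (LINT p|lebesgue_on ?P. fl p * hl p)"
    by (intro tendsto_diff L2_tendsto_integral_mult F H)
  ultimately have "(LINT x|lebesgue_on (cbox l u). Df x * h x) + (LINT x|lebesgue_on (cbox l u). f x * Dh x)
      = (LINT p|lebesgue_on ?P. fu p * hu p) - (LINT p|lebesgue_on ?P. fl p * hl p)"
    using LIMSEQ_unique by auto
  then show ?thesis using int' by simp
qed

text \<open>Pairing a field with the constant \<open>1\<close> turns integration by parts into a formula for the
  integral of one partial derivative.\<close>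

lemma has_face_traces_1: "has_face_traces l u (\<lambda>x. 1) (\<lambda>x. 0) (\<lambda>p. 1) (\<lambda>p. 1)"
proof -
  have "compact ({l $ a..u $ a} \<times> {l $ b..u $ b})" by (intro compact_Times) auto
  then show ?thesis
    unfolding has_face_traces_def
    by (intro exI[of _ "\<lambda>k x. 1"] exI[of _ "\<lambda>k x. 0"])
      (auto intro!: L2_tendsto_const in_L2_continuous_on continuous_intros)
qed

text \<open>A weight is only differentiated on the segment between the two faces, so that it may have
  singularities elsewhere.\<close>

lemma has_face_traces_weight:
  assumes f: "has_face_traces l u f Df gl gu"
    and w: "\<And>c. c \<in> {l $ j..u $ j} \<Longrightarrow> (w has_real_derivative w' c) (at c within {l $ j..u $ j})"
    and w': "continuous_on {l $ j..u $ j} w'"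
  shows "has_face_traces l u (\<lambda>x. w (x $ j) * f x) (\<lambda>x. w' (x $ j) * f x + w (x $ j) * Df x)
     (\<lambda>p. w (l $ j) * gl p) (\<lambda>p. w (u $ j) * gu p)"
proof -
  let ?P = "{l $ a..u $ a} \<times> {l $ b..u $ b}"
  obtain F F' where F: "\<And>k. continuous_on (cbox l u) (F k)" "\<And>k. continuous_on (cbox l u) (F' k)"
      "\<And>k c p. face j a c p \<in> cbox l u \<Longrightarrow>
         ((\<lambda>c. F k (face j a c p)) has_real_derivative F' k (face j a c p)) (at c within {l $ j..u $ j})"
      "L2_tendsto (cbox l u) F f" "L2_tendsto (cbox l u) F' Df"
      "L2_tendsto ?P (\<lambda>k p. F k (face j a (l $ j) p)) gl" "L2_tendsto ?P (\<lambda>k p. F k (face j a (u $ j) p)) gu"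
    using f unfolding has_face_traces_def by blast
  have cw: "continuous_on {l $ j..u $ j} w" using w by (meson DERIV_continuous_on)
  have comp: "continuous_on (cbox l u) (\<lambda>x. v (x $ j))" if "continuous_on {l $ j..u $ j} v" for v :: "real \<Rightarrow> real"
    by (rule continuous_on_compose2[OF that]) (auto intro: continuous_intros simp: mem_box_cart)
  have mult: "L2_tendsto (cbox l u) (\<lambda>k x. v (x $ j) * A k x) (\<lambda>x. v (x $ j) * A' x)"
    if v: "continuous_on {l $ j..u $ j} v" and A: "L2_tendsto (cbox l u) A A'" for v :: "real \<Rightarrow> real" and A A'
  proof -
    obtain B where "\<And>c. c \<in> {l $ j..u $ j} \<Longrightarrow> \<bar>v c\<bar> \<le> B"
      using compact_imp_bounded[OF compact_continuous_image[OF v compact_Icc]]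
      unfolding bounded_iff by (metis imageI real_norm_def)
    then show ?thesis
      using comp[OF v] by (intro L2_tendsto_bounded_mult[OF A])
        (auto simp: mem_box_cart intro: continuous_imp_measurable_on_sets_lebesgue)
  qed
  show ?thesis
    unfolding has_face_traces_def
  proof (intro exI conjI allI impI)
    show "continuous_on (cbox l u) (\<lambda>x. w (x $ j) * F k x)" for k
      by (intro continuous_on_mult comp cw F)
    show "continuous_on (cbox l u) (\<lambda>x. w' (x $ j) * F k x + w (x $ j) * F' k x)" for k
      by (intro continuous_on_add continuous_on_mult comp cw w' F)
    show "((\<lambda>c. w (face j a c p $ j) * F k (face j a c p)) has_real_derivative
        w' (face j a c p $ j) * F k (face j a c p) + w (face j a c p $ j) * F' k (face j a c p)) (at c within {l $ j..u $ j})"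
      if "face j a c p \<in> cbox l u" for k c p
      using w[of c] F(3)[OF that] that by (auto simp: face_in_cbox intro!: derivative_eq_intros)
    show "L2_tendsto (cbox l u) (\<lambda>k x. w (x $ j) * F k x) (\<lambda>x. w (x $ j) * f x)"
      by (intro mult cw F)
    show "L2_tendsto (cbox l u) (\<lambda>k x. w' (x $ j) * F k x + w (x $ j) * F' k x) (\<lambda>x. w' (x $ j) * f x + w (x $ j) * Df x)"
      by (intro L2_tendsto_add mult cw w' F)
    show "L2_tendsto ?P (\<lambda>k p. w (face j a (l $ j) p $ j) * F k (face j a (l $ j) p)) (\<lambda>p. w (l $ j) * gl p)"
      using L2_tendsto_bounded_mult[OF F(6), of "\<lambda>_. w (l $ j)"] by auto
    show "L2_tendsto ?P (\<lambda>k p. w (face j a (u $ j) p $ j) * F k (face j a (u $ j) p)) (\<lambda>p. w (u $ j) * gu p)"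
      using L2_tendsto_bounded_mult[OF F(7), of "\<lambda>_. w (u $ j)"] by auto
  qed
qed

lemma smooth_limit_has_face_traces:
  fixes v :: "nat \<Rightarrow> real^3 \<Rightarrow> real^3"
  assumes v: "\<And>k. smooth (v k)" and n: "L2_tendsto (cbox l u) v n"
    and G: "L2_tendsto (cbox l u) (\<lambda>k x. jacobian (v k) (at x)) G"
    and gl: "L2_tendsto ({l $ a..u $ a} \<times> {l $ b..u $ b}) (\<lambda>k p. v k (face j a (l $ j) p)) gl"
    and gu: "L2_tendsto ({l $ a..u $ a} \<times> {l $ b..u $ b}) (\<lambda>k p. v k (face j a (u $ j) p)) gu"
  shows "has_face_traces l u (\<lambda>x. n x $ i) (\<lambda>x. G x $ i $ j) (\<lambda>p. gl p $ i) (\<lambda>p. gu p $ i)"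
  unfolding has_face_traces_def
proof (rule exI[of _ "\<lambda>k x. v k x $ i"], rule exI[of _ "\<lambda>k x. jacobian (v k) (at x) $ i $ j"],
    intro conjI allI impI)
  show "continuous_on (cbox l u) (\<lambda>x. v k x $ i)" for k
    by (intro continuous_intros smooth_imp_continuous_on v)
  show "continuous_on (cbox l u) (\<lambda>x. jacobian (v k) (at x) $ i $ j)" for k
    by (intro smooth_imp_continuous_on_jacobian v)
  show "((\<lambda>c. v k (face j a c p) $ i) has_real_derivative jacobian (v k) (at (face j a c p)) $ i $ j) (at c within {l $ j..u $ j})" for k c p
    by (intro smooth_component_partial_on_face v)
qed (intro L2_tendsto_nth L2_tendsto_entry n G gl gu)+

end

section \<open>Stability below the critical twist\<close>

interpretation X: axes 1 2 3 by unfold_locales auto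
interpretation Y: axes 2 1 3 by unfold_locales auto
interpretation Z: axes 3 1 2 by unfold_locales auto

lemma x_face_eq: "x_face c p = face 1 2 c p"
  and y_face_eq: "y_face c p = face 2 1 c p"
  and z_face_eq: "z_face c p = face 3 1 c p"
  by (auto simp: x_face_def y_face_def z_face_def face_def vec_eq_iff forall_3)

lemma box_domain_measurable: "box_domain L1 L2 \<in> sets lebesgue"
  by (simp add: box_domain_def)

lemma box_domain_negligible_boundary: "negligible (box_domain L1 L2 - interior (box_domain L1 L2))"
  by (simp add: box_domain_def interior_cbox negligible_frontier_interval)

text \<open>By periodicity the contributions of opposite lateral faces cancel. On the horizontal faces the
  traces of the first two components vanish, so there a weight depending on the height may be
  included.\<close>

lemma admissible_integral_identities:
  assumes n: "n \<in> admissible L1 L2" and L: "L1 > 0" "L2 > 0"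
  defines "G \<equiv> weak_grad (box_domain L1 L2) n"
  shows "in_L2 (box_domain L1 L2) n" "in_L2 (box_domain L1 L2) G"
    and "(LINT x|lebesgue_on (box_domain L1 L2). G x $ i $ 1) = 0"
    and "(LINT x|lebesgue_on (box_domain L1 L2). G x $ i $ 2) = 0"
    and "(LINT x|lebesgue_on (box_domain L1 L2). G x $ i $ 1 * n x $ k + n x $ i * G x $ k $ 1) = 0"
    and "(LINT x|lebesgue_on (box_domain L1 L2). G x $ i $ 2 * n x $ k + n x $ i * G x $ k $ 2) = 0"
    and "\<lbrakk>\<And>c. c \<in> {0..1} \<Longrightarrow> (w has_real_derivative w' c) (at c within {0..1}); continuous_on {0..1} w'; i \<noteq> 3\<rbrakk> \<Longrightarrow>
      (LINT x|lebesgue_on (box_domain L1 L2). (w' (x $ 3) * n x $ i + w (x $ 3) * G x $ i $ 3) * n x $ i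
         + w (x $ 3) * n x $ i * G x $ i $ 3) = 0"
proof -
  define l u :: "real^3" where "l = vector [- L1, - L2, 0]" and "u = vector [L1, L2, 1]"
  have lu: "l $ 1 = - L1" "l $ 2 = - L2" "l $ 3 = 0" "u $ 1 = L1" "u $ 2 = L2" "u $ 3 = 1"
    by (simp_all add: l_def u_def vector_3)
  have box: "box_domain L1 L2 = cbox l u" by (simp add: box_domain_def l_def u_def)
  obtain g where tr: "has_trace L1 L2 n g"
    and g0: "AE p in lebesgue_on ({- L1..L1} \<times> {- L2..L2}). g (z_face 0 p) = e3"
    and g1: "AE p in lebesgue_on ({- L1..L1} \<times> {- L2..L2}). g (z_face 1 p) = e3"
    and gx: "AE p in lebesgue_on ({- L2..L2} \<times> {0..1}). g (x_face (- L1) p) = g (x_face L1 p)"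
    and gy: "AE p in lebesgue_on ({- L1..L1} \<times> {0..1}). g (y_face (- L2) p) = g (y_face L2 p)"
    using n by (auto simp: admissible_def)
  then obtain v where v: "\<And>k. smooth (v k)" "L2_tendsto (cbox l u) v n"
      "L2_tendsto (cbox l u) (\<lambda>k x. jacobian (v k) (at x)) G"
    and vx: "\<And>c. c \<in> {- L1, L1} \<Longrightarrow> L2_tendsto ({- L2..L2} \<times> {0..1}) (\<lambda>k p. v k (x_face c p)) (\<lambda>p. g (x_face c p))"
    and vy: "\<And>c. c \<in> {- L2, L2} \<Longrightarrow> L2_tendsto ({- L1..L1} \<times> {0..1}) (\<lambda>k p. v k (y_face c p)) (\<lambda>p. g (y_face c p))"
    and vz: "\<And>c. c \<in> {0, 1} \<Longrightarrow> L2_tendsto ({- L1..L1} \<times> {- L2..L2}) (\<lambda>k p. v k (z_face c p)) (\<lambda>p. g (z_face c p))"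
    unfolding has_trace_def G_def box by blast
  show "in_L2 (box_domain L1 L2) n" "in_L2 (box_domain L1 L2) G"
    using v unfolding box by (auto simp: L2_tendsto_def)
  have X: "X.has_face_traces l u (\<lambda>x. n x $ i) (\<lambda>x. G x $ i $ 1) (\<lambda>p. g (x_face (- L1) p) $ i) (\<lambda>p. g (x_face L1 p) $ i)" for i
    using vx[of "- L1"] vx[of L1] by (intro X.smooth_limit_has_face_traces[OF v]) (auto simp: lu x_face_eq)
  have Y: "Y.has_face_traces l u (\<lambda>x. n x $ i) (\<lambda>x. G x $ i $ 2) (\<lambda>p. g (y_face (- L2) p) $ i) (\<lambda>p. g (y_face L2 p) $ i)" for i
    using vy[of "- L2"] vy[of L2] by (intro Y.smooth_limit_has_face_traces[OF v]) (auto simp: lu y_face_eq)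
  have Z: "Z.has_face_traces l u (\<lambda>x. n x $ i) (\<lambda>x. G x $ i $ 3) (\<lambda>p. g (z_face 0 p) $ i) (\<lambda>p. g (z_face 1 p) $ i)" for i
    using vz[of 0] vz[of 1] by (intro Z.smooth_limit_has_face_traces[OF v]) (auto simp: lu z_face_eq)
  have Xm: "(\<lambda>p. g (x_face c p) $ i) \<in> borel_measurable (lebesgue_on ({- L2..L2} \<times> {0..1}))" if "c \<in> {- L1, L1}" for c i
    using in_L2_nth[of _ _ i] vx[OF that] by (auto simp: L2_tendsto_def in_L2_def)
  have Ym: "(\<lambda>p. g (y_face c p) $ i) \<in> borel_measurable (lebesgue_on ({- L1..L1} \<times> {0..1}))" if "c \<in> {- L2, L2}" for c i
    using in_L2_nth[of _ _ i] vy[OF that] by (auto simp: L2_tendsto_def in_L2_def)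
  have Zm: "(\<lambda>p. g (z_face c p) $ i) \<in> borel_measurable (lebesgue_on ({- L1..L1} \<times> {- L2..L2}))" if "c \<in> {0, 1}" for c i
    using in_L2_nth[of _ _ i] vz[OF that] by (auto simp: L2_tendsto_def in_L2_def)
  have le: "l $ i \<le> u $ i" for i
    using L exhaust_3[of i] by (auto simp: lu)

  have "(LINT p|lebesgue_on ({- L2..L2} \<times> {0..1}). g (x_face L1 p) $ i)
      = (LINT p|lebesgue_on ({- L2..L2} \<times> {0..1}). g (x_face (- L1) p) $ i)" for i
    using gx by (intro integral_cong_AE Xm) auto
  then show "(LINT x|lebesgue_on (box_domain L1 L2). G x $ i $ 1) = 0"
    using X.integration_by_parts[OF X X.has_face_traces_1 le, of i] by (simp add: box lu)
  have "(LINT p|lebesgue_on ({- L1..L1} \<times> {0..1}). g (y_face L2 p) $ i)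
      = (LINT p|lebesgue_on ({- L1..L1} \<times> {0..1}). g (y_face (- L2) p) $ i)" for i
    using gy by (intro integral_cong_AE Ym) auto
  then show "(LINT x|lebesgue_on (box_domain L1 L2). G x $ i $ 2) = 0"
    using Y.integration_by_parts[OF Y Y.has_face_traces_1 le, of i] by (simp add: box lu)
  have "(LINT p|lebesgue_on ({- L2..L2} \<times> {0..1}). g (x_face L1 p) $ i * g (x_face L1 p) $ k)
      = (LINT p|lebesgue_on ({- L2..L2} \<times> {0..1}). g (x_face (- L1) p) $ i * g (x_face (- L1) p) $ k)"
    using gx by (intro integral_cong_AE borel_measurable_times Xm) auto
  then show "(LINT x|lebesgue_on (box_domain L1 L2). G x $ i $ 1 * n x $ k + n x $ i * G x $ k $ 1) = 0"
    using X.integration_by_parts[OF X X le, of i k] by (simp add: box lu)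
  have "(LINT p|lebesgue_on ({- L1..L1} \<times> {0..1}). g (y_face L2 p) $ i * g (y_face L2 p) $ k)
      = (LINT p|lebesgue_on ({- L1..L1} \<times> {0..1}). g (y_face (- L2) p) $ i * g (y_face (- L2) p) $ k)"
    using gy by (intro integral_cong_AE borel_measurable_times Ym) auto
  then show "(LINT x|lebesgue_on (box_domain L1 L2). G x $ i $ 2 * n x $ k + n x $ i * G x $ k $ 2) = 0"
    using Y.integration_by_parts[OF Y Y le, of i k] by (simp add: box lu)
  assume w: "\<And>c. c \<in> {0..1} \<Longrightarrow> (w has_real_derivative w' c) (at c within {0..1})" "continuous_on {0..1} w'"
    and i: "i \<noteq> 3"
  have W: "Z.has_face_traces l u (\<lambda>x. w (x $ 3) * n x $ i) (\<lambda>x. w' (x $ 3) * n x $ i + w (x $ 3) * G x $ i $ 3)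
      (\<lambda>p. w 0 * g (z_face 0 p) $ i) (\<lambda>p. w 1 * g (z_face 1 p) $ i)"
    using Z.has_face_traces_weight[OF Z, of w w' i] w by (simp add: lu)
  have e3i: "e3 $ i = 0" using i exhaust_3[of i] by (auto simp: e3_def vector_3)
  have z0: "(LINT p|lebesgue_on ({- L1..L1} \<times> {- L2..L2}). (w 0 * g (z_face 0 p) $ i) * g (z_face 0 p) $ i) = 0"
    proof (rule integral_eq_zero_AE)
    show "AE p in lebesgue_on ({- L1..L1} \<times> {- L2..L2}). (w 0 * g (z_face 0 p) $ i) * g (z_face 0 p) $ i = 0"
      using g0 by eventually_elim (simp add: e3i)
  qed
  have z1: "(LINT p|lebesgue_on ({- L1..L1} \<times> {- L2..L2}). (w 1 * g (z_face 1 p) $ i) * g (z_face 1 p) $ i) = 0"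
    proof (rule integral_eq_zero_AE)
    show "AE p in lebesgue_on ({- L1..L1} \<times> {- L2..L2}). (w 1 * g (z_face 1 p) $ i) * g (z_face 1 p) $ i = 0"
      using g1 by eventually_elim (simp add: e3i)
  qed
  show "(LINT x|lebesgue_on (box_domain L1 L2). (w' (x $ 3) * n x $ i + w (x $ 3) * G x $ i $ 3) * n x $ i
         + w (x $ 3) * n x $ i * G x $ i $ 3) = 0"
    using Z.integration_by_parts[OF W Z le, of i] z0 z1 by (simp add: box lu)
qed

text \<open>With \<open>w' = s^2 + w^2\<close> the terms containing \<open>z\<close>-derivatives of \<open>n1\<close>, \<open>n2\<close> are, up to
  \<open>(s^2 - t^2) (n1^2 + n2^2)\<close>, the squares of \<open>G13 + t n2 + w n1\<close> and \<open>G23 - t n1 + w n2\<close>. The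
  coupling of \<open>n3 - 1\<close> with the horizontal derivatives is absorbed by \<open>G21^2 + G12^2\<close> at the cost of
  \<open>8 t^2 (1 - n3)^2\<close>. On the unit sphere \<open>n1^2 + n2^2\<close> is at least \<open>1 - n3\<close> if \<open>n3 \<ge> 0\<close>, so
  that for small \<open>\<epsilon>\<close> this cost is a small part of the gain.\<close>

lemma energy_density_lower_bound:
  fixes G :: "real^3^3" and n :: "real^3"
  assumes unit: "norm n = 1" and close: "norm (e3 - n) \<le> \<epsilon>" and \<epsilon>: "\<epsilon> \<le> 1" and st: "t\<^sup>2 \<le> s\<^sup>2"
  shows "(s\<^sup>2 - t\<^sup>2 - 8 * t\<^sup>2 * \<epsilon>) * (1 - n $ 3) \<le>
     (norm G)\<^sup>2 + 2 * t * (n $ 2 * G $ 1 $ 3 - n $ 1 * G $ 2 $ 3) + 4 * t * (n $ 3 - 1) * (G $ 2 $ 1 - G $ 1 $ 2)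
     + (s\<^sup>2 + w\<^sup>2) * ((n $ 1)\<^sup>2 + (n $ 2)\<^sup>2) + 2 * w * (n $ 1 * G $ 1 $ 3 + n $ 2 * G $ 2 $ 3)"
proof -
  have n1: "(n $ 1)\<^sup>2 + (n $ 2)\<^sup>2 + (n $ 3)\<^sup>2 = 1"
    using unit by (simp add: norm_eq_1 inner_vec_def sum_3 power2_eq_square)
  have n3: "n $ 3 \<le> 1" using component_le_norm_cart[of n 3] unit by simp
  have c: "1 - n $ 3 \<le> \<epsilon>"
    using component_le_norm_cart[of "e3 - n" 3] close by (simp add: e3_def vector_3)
  have sq: "(n $ 1)\<^sup>2 + (n $ 2)\<^sup>2 = (1 - n $ 3) * (1 + n $ 3)"
    using n1 by (simp add: power2_eq_square algebra_simps)
  have "(1 - n $ 3) * 1 \<le> (1 - n $ 3) * (1 + n $ 3)"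
    using n3 c \<epsilon> by (intro mult_left_mono) auto
  then have "(s\<^sup>2 - t\<^sup>2) * (1 - n $ 3) \<le> (s\<^sup>2 - t\<^sup>2) * ((n $ 1)\<^sup>2 + (n $ 2)\<^sup>2)"
    using st unfolding sq by (intro mult_left_mono) auto
  moreover have "(1 - n $ 3) * (1 - n $ 3) \<le> \<epsilon> * (1 - n $ 3)"
    using c n3 by (intro mult_right_mono) auto
  then have "8 * t\<^sup>2 * ((1 - n $ 3) * (1 - n $ 3)) \<le> 8 * t\<^sup>2 * (\<epsilon> * (1 - n $ 3))"
    by (intro mult_left_mono) auto
  moreover have "(norm G)\<^sup>2 \<ge> (G $ 1 $ 3)\<^sup>2 + (G $ 2 $ 3)\<^sup>2 + (G $ 2 $ 1)\<^sup>2 + (G $ 1 $ 2)\<^sup>2"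
  proof -
    have "(norm G)\<^sup>2 = (\<Sum>i\<in>UNIV. \<Sum>j\<in>UNIV. (G $ i $ j)\<^sup>2)"
      unfolding power2_norm_eq_inner inner_vec_def by (simp add: power2_eq_square)
    then show ?thesis by (simp add: sum_3)
  qed
  moreover have "(G $ 2 $ 1)\<^sup>2 + (G $ 1 $ 2)\<^sup>2 + 4 * t * (n $ 3 - 1) * (G $ 2 $ 1 - G $ 1 $ 2)
      = (G $ 2 $ 1 + 2 * t * (n $ 3 - 1))\<^sup>2 + (G $ 1 $ 2 - 2 * t * (n $ 3 - 1))\<^sup>2
        - 8 * t\<^sup>2 * ((1 - n $ 3) * (1 - n $ 3))"
    by (simp add: power2_eq_square algebra_simps)
  moreover have "(G $ 1 $ 3)\<^sup>2 + (G $ 2 $ 3)\<^sup>2 + 2 * t * (n $ 2 * G $ 1 $ 3 - n $ 1 * G $ 2 $ 3)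
      + (s\<^sup>2 + w\<^sup>2) * ((n $ 1)\<^sup>2 + (n $ 2)\<^sup>2) + 2 * w * (n $ 1 * G $ 1 $ 3 + n $ 2 * G $ 2 $ 3)
      = (G $ 1 $ 3 + t * n $ 2 + w * n $ 1)\<^sup>2 + (G $ 2 $ 3 - t * n $ 1 + w * n $ 2)\<^sup>2
        + (s\<^sup>2 - t\<^sup>2) * ((n $ 1)\<^sup>2 + (n $ 2)\<^sup>2)"
    by (simp add: power2_eq_square algebra_simps)
  moreover have "0 \<le> (G $ 1 $ 3 + t * n $ 2 + w * n $ 1)\<^sup>2" "0 \<le> (G $ 2 $ 3 - t * n $ 1 + w * n $ 2)\<^sup>2"
    "0 \<le> (G $ 2 $ 1 + 2 * t * (n $ 3 - 1))\<^sup>2" "0 \<le> (G $ 1 $ 2 - 2 * t * (n $ 3 - 1))\<^sup>2" by simp_all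
  moreover have "(s\<^sup>2 - t\<^sup>2 - 8 * t\<^sup>2 * \<epsilon>) * (1 - n $ 3)
      = (s\<^sup>2 - t\<^sup>2) * (1 - n $ 3) - 8 * t\<^sup>2 * (\<epsilon> * (1 - n $ 3))"
    by (simp add: algebra_simps)
  ultimately show ?thesis by linarith
qed

text \<open>The weight \<open>w z = s tan (s (z - 1/2))\<close> solves the Riccati equation \<open>w' = s^2 + w^2\<close>. It stays
  bounded on the unit interval because \<open>s < pi\<close>, which is where the critical twist comes from.\<close>

definition riccati :: "real \<Rightarrow> real \<Rightarrow> real" where
  "riccati s z = s * tan (s * (z - 1 / 2))"

lemma riccati_cos_nonzero:
  assumes "0 < s" "s < pi" "z \<in> {0..1}"
  shows "cos (s * (z - 1 / 2)) \<noteq> 0"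
proof -
  have "\<bar>s * (z - 1 / 2)\<bar> \<le> s * (1 / 2)"
    using assms unfolding abs_mult by (intro mult_mono) (auto simp only: abs_le_iff, auto)
  then have "- (pi / 2) < s * (z - 1 / 2)" "s * (z - 1 / 2) < pi / 2" using assms by auto
  then show ?thesis using cos_gt_zero_pi by fastforce
qed

lemma riccati_deriv:
  assumes "0 < s" "s < pi" "z \<in> {0..1}"
  shows "(riccati s has_real_derivative s\<^sup>2 + (riccati s z)\<^sup>2) (at z within A)"
proof -
  have "((\<lambda>z. s * tan (s * (z - 1 / 2))) has_real_derivative s * (inverse ((cos (s * (z - 1 / 2)))\<^sup>2) * s)) (at z within A)"
    using riccati_cos_nonzero[OF assms] by (auto intro!: derivative_eq_intros)
  moreover have "s * (inverse ((cos (s * (z - 1 / 2)))\<^sup>2) * s) = s\<^sup>2 + (riccati s z)\<^sup>2"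
    using tan_sec[OF riccati_cos_nonzero[OF assms]]
    by (simp add: riccati_def power_mult_distrib power_inverse power2_eq_square algebra_simps)
      (metis (no_types, opaque_lifting) distrib_left mult.commute mult.right_neutral power2_eq_square mult.left_commute)
  ultimately show ?thesis unfolding riccati_def[abs_def] by simp
qed

lemma riccati_continuous_on:
  assumes "0 < s" "s < pi"
  shows "continuous_on {0..1} (riccati s)"
  using riccati_deriv[OF assms] by (meson DERIV_continuous_on)

text \<open>The integral identities for admissible fields allow replacing the energy density by the
  expression estimated in \<open>energy_density_lower_bound\<close>.\<close>

lemma energy_excess_lower_bound:
  assumes n: "n \<in> admissible L1 L2" and L: "L1 > 0" "L2 > 0"
    and close: "AE x in lebesgue_on (box_domain L1 L2). norm (e3 - n x) \<le> \<epsilon>" and \<epsilon>: "\<epsilon> \<le> 1"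
    and s: "0 < s" "s < pi" and st: "t\<^sup>2 \<le> s\<^sup>2"
  defines "q \<equiv> \<lambda>x. (norm (weak_grad (box_domain L1 L2) n x))\<^sup>2
     + 2 * t * (n x \<bullet> weak_curl (box_domain L1 L2) n x)"
  shows "integrable (lebesgue_on (box_domain L1 L2)) q"
    and "integrable (lebesgue_on (box_domain L1 L2)) (\<lambda>x. 1 - n x $ 3)"
    and "(s\<^sup>2 - t\<^sup>2 - 8 * t\<^sup>2 * \<epsilon>) * (LINT x|lebesgue_on (box_domain L1 L2). 1 - n x $ 3)
      \<le> (LINT x|lebesgue_on (box_domain L1 L2). q x)"
proof -
  let ?\<Omega> = "box_domain L1 L2"
  define G where "G = weak_grad ?\<Omega> n"
  define w where "w x = riccati s (x $ 3)" for x :: "real^3"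
  note id = admissible_integral_identities[OF n L, folded G_def]
  have comp\<Omega>: "compact ?\<Omega>" by (simp add: box_domain_def compact_cbox)
  have nL: "in_L2 ?\<Omega> (\<lambda>x. n x $ i)" for i by (rule in_L2_nth[OF id(1)])
  have GL: "in_L2 ?\<Omega> (\<lambda>x. G x $ i $ j)" for i j by (intro in_L2_nth id(2))
  have oneL: "in_L2 ?\<Omega> (\<lambda>x. 1::real)" by (intro in_L2_continuous_on comp\<Omega> continuous_intros)
  have nint: "integrable (lebesgue_on ?\<Omega>) (\<lambda>x. n x $ i)" for i
    using in_L2_mult_integrable[OF nL[of i] oneL] by simp
  have Gint: "integrable (lebesgue_on ?\<Omega>) (\<lambda>x. G x $ i $ j)" for i j
    using in_L2_mult_integrable[OF GL[of i j] oneL] by simp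
  have nG: "integrable (lebesgue_on ?\<Omega>) (\<lambda>x. n x $ k * G x $ i $ j)" for i j k
    by (rule in_L2_mult_integrable[OF nL GL])
  have Gn: "integrable (lebesgue_on ?\<Omega>) (\<lambda>x. G x $ i $ j * n x $ k)" for i j k
    by (rule in_L2_mult_integrable[OF GL nL])
  have z: "x $ 3 \<in> {0..1}" if "x \<in> ?\<Omega>" for x
    using that by (auto simp: box_domain_def mem_box_cart vector_3 dest: spec[of _ 3])
  have wc: "continuous_on ?\<Omega> w"
    unfolding w_def by (rule continuous_on_compose2[OF riccati_continuous_on[OF s]])
      (use z in \<open>auto intro: continuous_intros\<close>)
  have bdd: "in_L2 ?\<Omega> (\<lambda>x. v x * f x)" if v: "continuous_on ?\<Omega> v" and f: "in_L2 ?\<Omega> f" for v f :: "real^3 \<Rightarrow> real"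
  proof -
    obtain B where "\<And>x. x \<in> ?\<Omega> \<Longrightarrow> \<bar>v x\<bar> \<le> B"
      using compact_imp_bounded[OF compact_continuous_image[OF v comp\<Omega>]]
      unfolding bounded_iff by (metis imageI real_norm_def)
    then show ?thesis
      by (intro in_L2_bounded_mult[OF f] continuous_imp_measurable_on_sets_lebesgue v box_domain_measurable)
  qed
  \<comment> \<open>The weighted identity in the direction of the third axis.\<close>
  define A where "A i x = ((s\<^sup>2 + (w x)\<^sup>2) * n x $ i + w x * G x $ i $ 3) * n x $ i + w x * n x $ i * G x $ i $ 3" for i x
  have Aint: "integrable (lebesgue_on ?\<Omega>) (A i)" for i
    unfolding A_def
    by (intro Bochner_Integration.integrable_add in_L2_mult_integrable in_L2_add bdd nL GL continuous_intros wc)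
  have A0: "(LINT x|lebesgue_on ?\<Omega>. A i x) = 0" if "i \<noteq> 3" for i
    unfolding A_def w_def using s that
    by (intro id(7)) (auto intro!: riccati_deriv continuous_intros riccati_continuous_on)
  have curl: "n x \<bullet> weak_curl ?\<Omega> n x = n x $ 1 * G x $ 3 $ 2 - n x $ 1 * G x $ 2 $ 3
      + (n x $ 2 * G x $ 1 $ 3 - n x $ 2 * G x $ 3 $ 1) + (n x $ 3 * G x $ 2 $ 1 - n x $ 3 * G x $ 1 $ 2)" for x
    by (simp add: weak_curl_def curl_of_grad_def inner_vec_def sum_3 vector_3 G_def algebra_simps)
  have "integrable (lebesgue_on ?\<Omega>) (\<lambda>x. n x \<bullet> weak_curl ?\<Omega> n x)"
    unfolding curl by (intro Bochner_Integration.integrable_add Bochner_Integration.integrable_diff nG)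
  then show qint: "integrable (lebesgue_on ?\<Omega>) q"
    using id(2) unfolding q_def in_L2_def G_def
    by (intro Bochner_Integration.integrable_add integrable_mult_right) auto
  have "integrable (lebesgue_on ?\<Omega>) (\<lambda>x. 1::real)"
    using in_L2_mult_integrable[OF oneL oneL] by simp
  then show int3: "integrable (lebesgue_on ?\<Omega>) (\<lambda>x. 1 - n x $ 3)"
    using nint by simp
  define r where "r x = (norm (G x))\<^sup>2 + 2 * t * (n x $ 2 * G x $ 1 $ 3 - n x $ 1 * G x $ 2 $ 3)
     + 4 * t * (n x $ 3 - 1) * (G x $ 2 $ 1 - G x $ 1 $ 2)
     + (s\<^sup>2 + (w x)\<^sup>2) * ((n x $ 1)\<^sup>2 + (n x $ 2)\<^sup>2) + 2 * w x * (n x $ 1 * G x $ 1 $ 3 + n x $ 2 * G x $ 2 $ 3)" for x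
  \<comment> \<open>The periodic identities, combined so that the horizontal derivatives of \<open>n3\<close> disappear from the
    curl term and \<open>n3\<close> is replaced by \<open>n3 - 1\<close>.\<close>
  define B where "B x = (- (2 * t)) * (G x $ 1 $ 2 * n x $ 3 + n x $ 1 * G x $ 3 $ 2)
     + (2 * t) * (G x $ 2 $ 1 * n x $ 3 + n x $ 2 * G x $ 3 $ 1) + (- (4 * t)) * G x $ 2 $ 1 + (4 * t) * G x $ 1 $ 2" for x
  have r: "r x = q x + B x + A 1 x + A 2 x" for x
    unfolding r_def q_def B_def A_def curl G_def[symmetric]
    by (simp add: power2_eq_square algebra_simps)
  have Bint: "integrable (lebesgue_on ?\<Omega>) B"
    unfolding B_def by (intro Bochner_Integration.integrable_add integrable_mult_right Gint nG Gn)
  have B0: "(LINT x|lebesgue_on ?\<Omega>. B x) = 0"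
  proof -
    have int: "integrable (lebesgue_on ?\<Omega>) (\<lambda>x. G x $ 1 $ 2 * n x $ 3 + n x $ 1 * G x $ 3 $ 2)"
      "integrable (lebesgue_on ?\<Omega>) (\<lambda>x. G x $ 2 $ 1 * n x $ 3 + n x $ 2 * G x $ 3 $ 1)"
      by (intro Bochner_Integration.integrable_add nG Gn)+
    have "(LINT x|lebesgue_on ?\<Omega>. B x)
       = (- (2 * t)) * (LINT x|lebesgue_on ?\<Omega>. G x $ 1 $ 2 * n x $ 3 + n x $ 1 * G x $ 3 $ 2)
       + (2 * t) * (LINT x|lebesgue_on ?\<Omega>. G x $ 2 $ 1 * n x $ 3 + n x $ 2 * G x $ 3 $ 1)
       + (- (4 * t)) * (LINT x|lebesgue_on ?\<Omega>. G x $ 2 $ 1) + (4 * t) * (LINT x|lebesgue_on ?\<Omega>. G x $ 1 $ 2)"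
      unfolding B_def integral_mult_right_zero[symmetric]
      by (simp only: Bochner_Integration.integral_add[symmetric] Bochner_Integration.integrable_add
          integrable_mult_right int Gint)
    then show ?thesis by (simp only: id(3-6))
  qed
  have "(LINT x|lebesgue_on ?\<Omega>. r x)
      = (LINT x|lebesgue_on ?\<Omega>. q x) + (LINT x|lebesgue_on ?\<Omega>. B x) + (LINT x|lebesgue_on ?\<Omega>. A 1 x) + (LINT x|lebesgue_on ?\<Omega>. A 2 x)"
    unfolding r using qint Bint Aint by simp
  then have rq: "(LINT x|lebesgue_on ?\<Omega>. r x) = (LINT x|lebesgue_on ?\<Omega>. q x)"
    by (simp add: B0 A0)
  have rint: "integrable (lebesgue_on ?\<Omega>) r"
    unfolding r[abs_def] by (intro Bochner_Integration.integrable_add qint Bint Aint)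
  have "AE x in lebesgue_on ?\<Omega>. norm (n x) = 1"
    using n by (simp add: admissible_def W12_sphere_def)
  then have ae: "AE x in lebesgue_on ?\<Omega>. (s\<^sup>2 - t\<^sup>2 - 8 * t\<^sup>2 * \<epsilon>) * (1 - n x $ 3) \<le> r x"
    using close
  proof eventually_elim
    case (elim x)
    then show ?case unfolding r_def by (intro energy_density_lower_bound \<epsilon> st)
  qed
  have "(s\<^sup>2 - t\<^sup>2 - 8 * t\<^sup>2 * \<epsilon>) * (LINT x|lebesgue_on ?\<Omega>. 1 - n x $ 3)
      = (LINT x|lebesgue_on ?\<Omega>. (s\<^sup>2 - t\<^sup>2 - 8 * t\<^sup>2 * \<epsilon>) * (1 - n x $ 3))" by simp
  also have "\<dots> \<le> (LINT x|lebesgue_on ?\<Omega>. r x)"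
    using ae by (intro integral_mono_AE rint integrable_mult_right int3)
  finally show "(s\<^sup>2 - t\<^sup>2 - 8 * t\<^sup>2 * \<epsilon>) * (LINT x|lebesgue_on ?\<Omega>. 1 - n x $ 3)
      \<le> (LINT x|lebesgue_on ?\<Omega>. q x)" unfolding rq .
qed

lemma unit_eq_e3_iff: "norm n = 1 \<Longrightarrow> n $ 3 = 1 \<longleftrightarrow> n = e3"
proof
  assume "norm n = 1" "n $ 3 = 1"
  moreover have "(n $ 1)\<^sup>2 + (n $ 2)\<^sup>2 + (n $ 3)\<^sup>2 = (norm n)\<^sup>2"
    unfolding power2_norm_eq_inner inner_vec_def by (simp add: sum_3 power2_eq_square)
  ultimately have "n $ 1 = 0" "n $ 2 = 0" by (simp_all add: sum_power2_eq_zero_iff)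
  then show "n = e3" using \<open>n $ 3 = 1\<close> by (simp add: e3_def vec_eq_iff forall_3 vector_3)
qed (simp add: e3_def vector_3)

text \<open>The energy excess controls the integral of \<open>1 - n3\<close>, and this vanishes for unit vectors only
  where they equal \<open>e3\<close>.\<close>

lemma e3_strict_strong_local_minimizer:
  assumes K: "K > 0" and t: "t \<ge> 0" "t < pi" and L: "L1 > 0" "L2 > 0"
    and e3: "(\<lambda>x. e3) \<in> admissible L1 L2"
      "energy K t L1 L2 (\<lambda>x. e3) = K * (LINT x|lebesgue_on (box_domain L1 L2). t\<^sup>2)"
  shows "strict_strong_local_minimizer (box_domain L1 L2) (admissible L1 L2) (energy K t L1 L2) (\<lambda>x. e3)"
proof -
  let ?\<Omega> = "box_domain L1 L2"
  define s where "s = (t + pi) / 2"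
  have s: "0 < s" "s < pi" "t < s" using t by (auto simp: s_def)
  then have st: "t\<^sup>2 < s\<^sup>2" using t by (intro power_strict_mono) auto
  \<comment> \<open>This bound makes the factor \<open>s^2 - t^2 - 8 t^2 \<epsilon>\<close> of the energy excess positive, also for \<open>t = 0\<close>.\<close>
  define \<epsilon> where "\<epsilon> = min 1 ((s\<^sup>2 - t\<^sup>2) / (8 * t\<^sup>2 + 1))"
  have pos: "0 < 8 * t\<^sup>2 + 1" by (simp add: add_nonneg_pos)
  then have \<epsilon>: "0 < \<epsilon>" "\<epsilon> \<le> 1" using st by (auto simp: \<epsilon>_def)
  have "\<epsilon> \<le> (s\<^sup>2 - t\<^sup>2) / (8 * t\<^sup>2 + 1)" by (simp add: \<epsilon>_def)
  then have "(8 * t\<^sup>2 + 1) * \<epsilon> \<le> s\<^sup>2 - t\<^sup>2"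
    by (simp only: pos_le_divide_eq[OF pos] mult.commute)
  then have coeff: "0 < s\<^sup>2 - t\<^sup>2 - 8 * t\<^sup>2 * \<epsilon>" using \<epsilon> by (simp add: algebra_simps)
  have "energy K t L1 L2 (\<lambda>x. e3) < energy K t L1 L2 m"
    if m: "m \<in> admissible L1 L2" and m0: "0 < Linf_norm ?\<Omega> (\<lambda>x. e3 - m x)"
      and m\<epsilon>: "Linf_norm ?\<Omega> (\<lambda>x. e3 - m x) < ereal \<epsilon>" for m
  proof -
    have close: "AE x in lebesgue_on ?\<Omega>. norm (e3 - m x) \<le> \<epsilon>"
      using esssup_AE[of "\<lambda>x. ereal (norm (e3 - m x))" "lebesgue_on ?\<Omega>"]
    proof eventually_elim
      case (elim x)
      then have "ereal (norm (e3 - m x)) \<le> ereal \<epsilon>"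
        using m\<epsilon> unfolding Linf_norm_def by (meson less_imp_le order_trans)
      then show ?case by simp
    qed
    note bound = energy_excess_lower_bound[OF m L close \<epsilon>(2) s(1,2) less_imp_le[OF st]]
    have unit: "AE x in lebesgue_on ?\<Omega>. norm (m x) = 1"
      using m by (simp add: admissible_def W12_sphere_def)
    have nonneg: "AE x in lebesgue_on ?\<Omega>. 0 \<le> 1 - m x $ 3"
      using unit
    proof eventually_elim
      case (elim x)
      then show ?case using component_le_norm_cart[of "m x" 3] by simp
    qed
    have "(LINT x|lebesgue_on ?\<Omega>. 1 - m x $ 3) \<noteq> 0"
    proof
      assume "(LINT x|lebesgue_on ?\<Omega>. 1 - m x $ 3) = 0"
      then have "AE x in lebesgue_on ?\<Omega>. 1 - m x $ 3 = 0"
        using integral_nonneg_eq_0_iff_AE[OF bound(2) nonneg] by simp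
      then have eq: "AE x in lebesgue_on ?\<Omega>. ereal (norm (e3 - m x)) \<le> 0"
        using unit by eventually_elim (use unit_eq_e3_iff in auto)
      have "m \<in> borel_measurable (lebesgue_on ?\<Omega>)"
        using m by (auto simp: admissible_def W12_sphere_def W12_def in_L2_def)
      then have "(\<lambda>x. ereal (norm (e3 - m x))) \<in> borel_measurable (lebesgue_on ?\<Omega>)" by measurable
      then have "Linf_norm ?\<Omega> (\<lambda>x. e3 - m x) \<le> 0"
        unfolding Linf_norm_def using eq by (rule esssup_I)
      with m0 show False by simp
    qed
    then have "0 < (LINT x|lebesgue_on ?\<Omega>. 1 - m x $ 3)"
      using integral_nonneg_AE[OF nonneg] by simp
    then have q: "0 < (LINT x|lebesgue_on ?\<Omega>. (norm (weak_grad ?\<Omega> m x))\<^sup>2 + 2 * t * (m x \<bullet> weak_curl ?\<Omega> m x))"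
      using mult_pos_pos[OF coeff] bound(3) by (meson less_le_trans)
    have "in_L2 ?\<Omega> (\<lambda>x. t)" by (intro in_L2_continuous_on continuous_intros) (simp add: box_domain_def)
    then have "integrable (lebesgue_on ?\<Omega>) (\<lambda>x. t\<^sup>2)" by (simp add: in_L2_def)
    then have "energy K t L1 L2 m = K * ((LINT x|lebesgue_on ?\<Omega>. (norm (weak_grad ?\<Omega> m x))\<^sup>2
          + 2 * t * (m x \<bullet> weak_curl ?\<Omega> m x)) + (LINT x|lebesgue_on ?\<Omega>. t\<^sup>2))"
      unfolding energy_def using bound(1) by (subst Bochner_Integration.integral_add) auto
    then show ?thesis using q K unfolding e3(2) by simp
  qed
  then show ?thesis
    unfolding strict_strong_local_minimizer_def using e3(1) \<epsilon>(1) by blast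
qed

section \<open>Smooth fields and their weak gradients\<close>

text \<open>Completeness of Lebesgue measure is used because a chosen weak gradient is known up to null sets only.\<close>

lemma measurable_AE_lebesgue_on:
  fixes f g :: "'a::euclidean_space \<Rightarrow> 'b::euclidean_space"
  assumes S: "S \<in> sets lebesgue" and f: "f \<in> borel_measurable (lebesgue_on S)"
    and ae: "AE x in lebesgue_on S. f x = g x"
  shows "g \<in> borel_measurable (lebesgue_on S)"
proof -
  have "(\<lambda>x. if x \<in> S then f x else 0) \<in> borel_measurable lebesgue"
    using f S by (simp add: borel_measurable_if)
  moreover have "AE x in lebesgue. (if x \<in> S then f x else 0) = (if x \<in> S then g x else 0)"
    using ae S by (simp add: AE_restrict_space_iff)
  ultimately have "(\<lambda>x. if x \<in> S then g x else 0) \<in> borel_measurable lebesgue"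
    by (rule borel_measurable_AE)
  then show ?thesis using S by (simp add: borel_measurable_if)
qed

lemma integral_cong_AE_lebesgue_on:
  fixes f g :: "'a::euclidean_space \<Rightarrow> 'b::euclidean_space"
  assumes "S \<in> sets lebesgue" "f \<in> borel_measurable (lebesgue_on S)" "AE x in lebesgue_on S. f x = g x"
  shows "(LINT x|lebesgue_on S. f x) = (LINT x|lebesgue_on S. g x)"
  using assms measurable_AE_lebesgue_on[OF assms] by (intro integral_cong_AE) auto

lemma ex_axes: "\<exists>a b. axes j a b"
proof -
  consider "j = 1" | "j = 2" | "j = 3" using exhaust_3 by blast
  then show ?thesis by cases (auto intro: X.axes_axioms Y.axes_axioms Z.axes_axioms)
qed

lemma absolutely_integrable_compact_continuous:
  fixes f :: "'a::euclidean_space \<Rightarrow> 'b::euclidean_space"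
  assumes "compact C" "continuous_on C f"
  shows "f absolutely_integrable_on C"
proof -
  have int: "integrable lborel (\<lambda>x. indicator C x *\<^sub>R f x)"
    by (rule borel_integrable_compact[OF assms])
  then have "integrable lebesgue (\<lambda>x. indicator C x *\<^sub>R f x)"
    by (subst integrable_completion) (auto intro: borel_measurable_integrable)
  then show ?thesis by (simp add: set_integrable_def)
qed

lemma smooth_continuous_on_jacobian_matrix:
  fixes v :: "real^'n \<Rightarrow> real^'m"
  assumes "smooth v"
  shows "continuous_on S (\<lambda>x. jacobian v (at x))"
proof -
  have "continuous_on S (\<lambda>x. \<chi> i j. jacobian v (at x) $ i $ j)"
    by (intro continuous_on_vec_lambda smooth_imp_continuous_on_jacobian assms)
  then show ?thesis by simp
qed

text \<open>The product of a component with a test function vanishes on the faces, so the divergence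
  theorem has no boundary terms.\<close>

lemma smooth_is_weak_gradient:
  fixes v :: "real^3 \<Rightarrow> real^'m"
  assumes v: "smooth v" and le: "\<And>i. l $ i \<le> u $ i"
  shows "is_weak_gradient (cbox l u) v (\<lambda>x. jacobian v (at x))"
  unfolding is_weak_gradient_def
proof (intro conjI allI impI)
  fix C :: "(real^3) set" assume C: "compact C \<and> C \<subseteq> interior (cbox l u)"
  then show "v absolutely_integrable_on C" "(\<lambda>x. jacobian v (at x)) absolutely_integrable_on C"
    by (auto intro!: absolutely_integrable_compact_continuous smooth_imp_continuous_on
        smooth_continuous_on_jacobian_matrix v)
next
  fix \<phi> :: "real^3 \<Rightarrow> real" and i j assume \<phi>: "test_function (cbox l u) \<phi>"
  then have s\<phi>: "smooth \<phi>" by (simp add: test_function_def)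
  obtain a b where "axes j a b" using ex_axes by blast
  then interpret axes j a b .
  let ?P = "{l $ a..u $ a} \<times> {l $ b..u $ b}"
  let ?D = "\<lambda>x. frechet_derivative \<phi> (at x) (axis j 1)"
  have zero: "\<phi> x = 0" if "x \<notin> box l u" for x
    using \<phi> that closure_subset[of "{x. \<phi> x \<noteq> 0}"] by (auto simp: test_function_def interior_cbox)
  have int: "integrable (lebesgue_on (cbox l u)) f" if "continuous_on (cbox l u) f" for f :: "real^3 \<Rightarrow> real"
    using absolutely_integrable_compact_continuous[OF compact_cbox that]
    by (intro absolutely_integrable_imp_integrable) auto
  have c: "continuous_on (cbox l u) (\<lambda>x. v x $ i * ?D x)" "continuous_on (cbox l u) (\<lambda>x. jacobian v (at x) $ i $ j * \<phi> x)"
    by (intro continuous_intros smooth_imp_continuous_on smooth_imp_continuous_on_jacobian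
        smooth_imp_continuous_on_partial v s\<phi>)+
  have "(LINT x|lebesgue_on (cbox l u). v x $ i * ?D x + jacobian v (at x) $ i $ j * \<phi> x)
      = (LINT p|lebesgue_on ?P. v (face j a (u $ j) p) $ i * \<phi> (face j a (u $ j) p))
      - (LINT p|lebesgue_on ?P. v (face j a (l $ j) p) $ i * \<phi> (face j a (l $ j) p))"
  proof (rule integral_partial_derivative[where f = "\<lambda>x. v x $ i * \<phi> x"])
    show "((\<lambda>c. v (face j a c p) $ i * \<phi> (face j a c p)) has_real_derivative
        v (face j a c p) $ i * ?D (face j a c p) + jacobian v (at (face j a c p)) $ i $ j * \<phi> (face j a c p))
        (at c within {l $ j..u $ j})" for c p
      using smooth_component_partial_on_face[OF v] smooth_partial_on_face[OF s\<phi>]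
      by (intro DERIV_mult') (auto simp: has_real_derivative_iff_has_vector_derivative)
    show "continuous_on (cbox l u) (\<lambda>x. v x $ i * \<phi> x)"
      by (intro continuous_intros smooth_imp_continuous_on v s\<phi>)
  qed (intro le continuous_on_add c)+
  also have "\<dots> = 0"
    by (simp add: zero face_in_box)
  finally show "(LINT x|lebesgue_on (cbox l u). v x $ i * ?D x)
      = - (LINT x|lebesgue_on (cbox l u). jacobian v (at x) $ i $ j * \<phi> x)"
    using int[OF c(1)] int[OF c(2)] by simp
qed

lemma weak_grad_smooth:
  assumes "smooth v" "L1 > 0" "L2 > 0"
  shows "is_weak_gradient (box_domain L1 L2) v (\<lambda>x. jacobian v (at x))"
    and "AE x in lebesgue_on (box_domain L1 L2). weak_grad (box_domain L1 L2) v x = jacobian v (at x)"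
proof -
  have "(vector [- L1, - L2, 0] :: real^3) $ i \<le> (vector [L1, L2, 1] :: real^3) $ i" for i
    using assms exhaust_3[of i] by (auto simp: vector_3)
  then show *: "is_weak_gradient (box_domain L1 L2) v (\<lambda>x. jacobian v (at x))"
    unfolding box_domain_def by (rule smooth_is_weak_gradient[OF assms(1)])
  show "AE x in lebesgue_on (box_domain L1 L2). weak_grad (box_domain L1 L2) v x = jacobian v (at x)"
    by (rule weak_grad_eq[OF * box_domain_measurable box_domain_negligible_boundary])
qed

lemma integrable_continuous_box_domain:
  fixes f :: "real^3 \<Rightarrow> real"
  assumes "continuous_on (box_domain L1 L2) f"
  shows "integrable (lebesgue_on (box_domain L1 L2)) f"
proof -
  have "f absolutely_integrable_on box_domain L1 L2"
    by (intro absolutely_integrable_compact_continuous assms) (simp add: box_domain_def compact_cbox)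
  then show ?thesis
    by (rule absolutely_integrable_imp_integrable) (rule box_domain_measurable)
qed

lemma box_domain_volume_pos: "L1 > 0 \<Longrightarrow> L2 > 0 \<Longrightarrow> (LINT x|lebesgue_on (box_domain L1 L2). 1::real) > 0"
proof -
  assume L: "L1 > 0" "L2 > 0"
  have "box (vector [- L1, - L2, 0] :: real^3) (vector [L1, L2, 1]) \<noteq> {}"
    using L by (simp add: interval_ne_empty_cart forall_3 vector_3)
  then have "measure lebesgue (box_domain L1 L2) > 0"
    unfolding box_domain_def by (metis content_pos_lt_eq measure_completion box_ne_empty(2) sets_lborel borel_closed closed_cbox)
  then show ?thesis
    by (simp add: measure_restrict_space box_domain_measurable)
qed

section \<open>Fields depending on the height alone\<close>

lemma jacobian_profile:
  assumes "\<And>c. (h has_vector_derivative h' c) (at c)"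
  shows "jacobian (\<lambda>x::real^'n. h (x $ k)) (at x) $ i $ j = (if j = k then h' (x $ k) $ i else 0)"
  unfolding jacobian_nth has_derivative_imp_frechet[OF has_derivative_profile[OF assms]]
  by (simp add: axis_def)

text \<open>Such a field is periodic, and being smooth across the boundary it has its own restriction as a
  trace: the constant sequence approximates it.\<close>

lemma profile_admissible:
  fixes h :: "real \<Rightarrow> real^3"
  assumes s: "smooth (\<lambda>x::real^3. h (x $ 3))" and unit: "\<And>c. norm (h c) = 1" and ends: "h 0 = e3" "h 1 = e3"
    and L: "L1 > 0" "L2 > 0"
  shows "(\<lambda>x. h (x $ 3)) \<in> admissible L1 L2"
proof -
  let ?\<Omega> = "box_domain L1 L2" and ?m = "\<lambda>x::real^3. h (x $ 3)"
  note wg = weak_grad_smooth[OF s L]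
  have comp: "compact ?\<Omega>" by (simp add: box_domain_def compact_cbox)
  have mL: "in_L2 ?\<Omega> ?m" by (intro in_L2_continuous_on comp smooth_imp_continuous_on s)
  have JL: "in_L2 ?\<Omega> (\<lambda>x. jacobian ?m (at x))"
    by (intro in_L2_continuous_on comp smooth_continuous_on_jacobian_matrix s)
  have ae: "AE x in lebesgue_on ?\<Omega>. jacobian ?m (at x) = weak_grad ?\<Omega> ?m x"
    using wg(2) by eventually_elim simp
  have Wm: "weak_grad ?\<Omega> ?m \<in> borel_measurable (lebesgue_on ?\<Omega>)"
    using JL unfolding in_L2_def by (intro measurable_AE_lebesgue_on[OF box_domain_measurable _ ae]) auto
  have WL: "in_L2 ?\<Omega> (weak_grad ?\<Omega> ?m)"
  proof -
    have "integrable (lebesgue_on ?\<Omega>) (\<lambda>x. (norm (weak_grad ?\<Omega> ?m x))\<^sup>2)"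
    proof (rule integrable_cong_AE_imp)
      show "integrable (lebesgue_on ?\<Omega>) (\<lambda>x. (norm (jacobian ?m (at x)))\<^sup>2)" using JL by (simp add: in_L2_def)
      show "(\<lambda>x. (norm (weak_grad ?\<Omega> ?m x))\<^sup>2) \<in> borel_measurable (lebesgue_on ?\<Omega>)" using Wm by measurable
      show "AE x in lebesgue_on ?\<Omega>. (norm (jacobian ?m (at x)))\<^sup>2 = (norm (weak_grad ?\<Omega> ?m x))\<^sup>2"
        using ae by eventually_elim simp
    qed
    then show ?thesis using Wm by (simp add: in_L2_def)
  qed
  have facec: "continuous_on S (\<lambda>p. ?m (x_face c p))" "continuous_on S (\<lambda>p. ?m (y_face c p))"
    "continuous_on S (\<lambda>p. ?m (z_face c p))" for c S
  proof -
    have "continuous_on S (\<lambda>p. ?m (f p))" if "continuous_on S f" for f :: "real \<times> real \<Rightarrow> real^3"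
      using continuous_on_compose2[OF smooth_imp_continuous_on[OF s, of UNIV] that] by simp
    then show "continuous_on S (\<lambda>p. ?m (x_face c p))" "continuous_on S (\<lambda>p. ?m (y_face c p))"
      "continuous_on S (\<lambda>p. ?m (z_face c p))"
      unfolding x_face_eq y_face_eq z_face_eq
      by (simp_all only: X.continuous_on_face[OF continuous_on_const continuous_on_id]
          Y.continuous_on_face[OF continuous_on_const continuous_on_id]
          Z.continuous_on_face[OF continuous_on_const continuous_on_id])
  qed
  have "has_trace L1 L2 ?m ?m"
    unfolding has_trace_def
  proof (intro exI[of _ "\<lambda>k. ?m"] conjI allI ballI)
    show "L2_tendsto ?\<Omega> (\<lambda>k x. jacobian ?m (at x)) (weak_grad ?\<Omega> ?m)"
      unfolding L2_tendsto_def
    proof (intro conjI allI JL WL)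
      have "(LINT x|lebesgue_on ?\<Omega>. (norm (jacobian ?m (at x) - weak_grad ?\<Omega> ?m x))\<^sup>2) = 0"
        by (rule integral_eq_zero_AE) (use ae in \<open>eventually_elim, simp\<close>)
      then show "(\<lambda>k. LINT x|lebesgue_on ?\<Omega>. (norm (jacobian ?m (at x) - weak_grad ?\<Omega> ?m x))\<^sup>2) \<longlonglongrightarrow> 0"
        by simp
    qed
  qed (intro s L2_tendsto_const in_L2_continuous_on facec compact_Times compact_Icc mL)+
  moreover have "x_face c p $ 3 = snd p" "y_face c p $ 3 = snd p" "z_face c p $ 3 = c" for c p
    by (simp_all add: x_face_def y_face_def z_face_def vector_3)
  ultimately show ?thesis
    using mL JL wg(1) unit ends unfolding admissible_def W12_sphere_def W12_def by (auto intro!: exI[of _ ?m])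
qed

lemma energy_profile:
  fixes h :: "real \<Rightarrow> real^3"
  assumes s: "smooth (\<lambda>x::real^3. h (x $ 3))" and h': "\<And>c. (h has_vector_derivative h' c) (at c)"
    and L: "L1 > 0" "L2 > 0"
  shows "energy K t L1 L2 (\<lambda>x. h (x $ 3)) = K * (LINT x|lebesgue_on (box_domain L1 L2).
     (norm (h' (x $ 3)))\<^sup>2 + 2 * t * (h (x $ 3) $ 2 * h' (x $ 3) $ 1 - h (x $ 3) $ 1 * h' (x $ 3) $ 2) + t\<^sup>2)"
proof -
  let ?\<Omega> = "box_domain L1 L2" and ?m = "\<lambda>x::real^3. h (x $ 3)"
  let ?F = "\<lambda>x::real^3. (norm (h' (x $ 3)))\<^sup>2
     + 2 * t * (h (x $ 3) $ 2 * h' (x $ 3) $ 1 - h (x $ 3) $ 1 * h' (x $ 3) $ 2) + t\<^sup>2"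
  note J = jacobian_profile[OF h', where k = "3::3"]
  have h'c: "continuous_on ?\<Omega> (\<lambda>x. h' (x $ 3))"
    using smooth_imp_continuous_on_partial[OF s, of ?\<Omega> 3]
    by (simp add: has_derivative_imp_frechet[OF has_derivative_profile[OF h']])
  have "(LINT x|lebesgue_on ?\<Omega>. ?F x)
      = (LINT x|lebesgue_on ?\<Omega>. (norm (weak_grad ?\<Omega> ?m x))\<^sup>2 + 2 * t * (?m x \<bullet> weak_curl ?\<Omega> ?m x) + t\<^sup>2)"
  proof (rule integral_cong_AE_lebesgue_on[OF box_domain_measurable])
    show "?F \<in> borel_measurable (lebesgue_on ?\<Omega>)"
      by (intro continuous_imp_measurable_on_sets_lebesgue box_domain_measurable continuous_intros h'c
          smooth_imp_continuous_on s)
    show "AE x in lebesgue_on ?\<Omega>. ?F x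
        = (norm (weak_grad ?\<Omega> ?m x))\<^sup>2 + 2 * t * (?m x \<bullet> weak_curl ?\<Omega> ?m x) + t\<^sup>2"
      using weak_grad_smooth(2)[OF s L]
    proof eventually_elim
      case (elim x)
      have "(norm (h' (x $ 3)))\<^sup>2 = (norm (jacobian ?m (at x)))\<^sup>2"
        unfolding power2_norm_eq_inner inner_vec_def by (simp add: sum_3 J)
      moreover have "h (x $ 3) $ 2 * h' (x $ 3) $ 1 - h (x $ 3) $ 1 * h' (x $ 3) $ 2
          = ?m x \<bullet> curl_of_grad (jacobian ?m (at x))"
        by (simp add: curl_of_grad_def inner_vec_def sum_3 vector_3 J)
      ultimately show ?case by (simp add: weak_curl_def elim)
    qed
  qed
  then show ?thesis by (simp add: energy_def)
qed

lemma smooth_const: "smooth (\<lambda>x. c)"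
  by (simp add: smooth_def C_k_const)

lemma e3_admissible:
  assumes "L1 > 0" "L2 > 0"
  shows "(\<lambda>x. e3) \<in> admissible L1 L2"
  using profile_admissible[of "\<lambda>c. e3", OF smooth_const _ _ _ assms]
  by (simp add: e3_def norm_eq_1 inner_vec_def sum_3 vector_3)

lemma energy_e3:
  assumes "L1 > 0" "L2 > 0"
  shows "energy K t L1 L2 (\<lambda>x. e3) = K * (LINT x|lebesgue_on (box_domain L1 L2). t\<^sup>2)"
  using energy_profile[of "\<lambda>c. e3" "\<lambda>c. 0", OF smooth_const _ assms] by simp

section \<open>Instability above the critical twist\<close>

definition tilt :: "real \<Rightarrow> real \<Rightarrow> real" where
  "tilt \<delta> c = \<delta> * sin (pi * c)"

text \<open>Tilted from \<open>e3\<close> by the first Dirichlet eigenfunction of the unit interval, with azimuth \<open>t c\<close>: the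
  rotation rate at which \<open>\<psi>'^2 - 2 t \<psi>'\<close>, the factor of \<open>sin^2\<close> of the tilt in the energy density of
  a field with azimuth \<open>\<psi>\<close>, is minimal.\<close>

definition helix :: "real \<Rightarrow> real \<Rightarrow> real \<Rightarrow> real^3" where
  "helix t \<delta> c = (\<chi> i. if i = 1 then sin (tilt \<delta> c) * cos (t * c)
     else if i = 2 then sin (tilt \<delta> c) * sin (t * c) else cos (tilt \<delta> c))"

definition helix_deriv :: "real \<Rightarrow> real \<Rightarrow> real \<Rightarrow> real^3" where
  "helix_deriv t \<delta> c = (\<chi> i.
     if i = 1 then \<delta> * pi * cos (pi * c) * cos (tilt \<delta> c) * cos (t * c) - t * sin (tilt \<delta> c) * sin (t * c)
     else if i = 2 then \<delta> * pi * cos (pi * c) * cos (tilt \<delta> c) * sin (t * c) + t * sin (tilt \<delta> c) * cos (t * c)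
     else - (\<delta> * pi * cos (pi * c)) * sin (tilt \<delta> c))"

lemma helix_has_vector_derivative: "(helix t \<delta> has_vector_derivative helix_deriv t \<delta> c) (at c)"
  unfolding helix_def[abs_def] helix_deriv_def
proof (rule has_vector_derivative_vec_lambda)
  fix i :: 3
  have tilt: "(tilt \<delta> has_real_derivative \<delta> * pi * cos (pi * c)) (at c)"
    unfolding tilt_def[abs_def] by (auto intro!: derivative_eq_intros)
  consider "i = 1" | "i = 2" | "i = 3" using exhaust_3 by blast
  then show "((\<lambda>c. if i = 1 then sin (tilt \<delta> c) * cos (t * c)
      else if i = 2 then sin (tilt \<delta> c) * sin (t * c) else cos (tilt \<delta> c)) has_vector_derivative
      (if i = 1 then \<delta> * pi * cos (pi * c) * cos (tilt \<delta> c) * cos (t * c) - t * sin (tilt \<delta> c) * sin (t * c)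
       else if i = 2 then \<delta> * pi * cos (pi * c) * cos (tilt \<delta> c) * sin (t * c) + t * sin (tilt \<delta> c) * cos (t * c)
       else - (\<delta> * pi * cos (pi * c)) * sin (tilt \<delta> c))) (at c)"
    by cases (auto intro!: derivative_eq_intros DERIV_chain'[OF tilt] tilt
        simp: has_real_derivative_iff_has_vector_derivative[symmetric])
qed

lemma smooth_helix: "smooth (\<lambda>x::real^3. helix t \<delta> (x $ 3))"
proof -
  let ?\<theta> = "\<lambda>z::complex. of_real \<delta> * sin (of_real pi * z)"
  define H :: "3 \<Rightarrow> complex \<Rightarrow> complex" where
    "H i z = (if i = 1 then sin (?\<theta> z) * cos (of_real t * z)
       else if i = 2 then sin (?\<theta> z) * sin (of_real t * z) else cos (?\<theta> z))" for i z
  have "H i holomorphic_on UNIV" for i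
  proof -
    consider "i = 1" | "i = 2" | "i = 3" using exhaust_3 by blast
    then show ?thesis unfolding H_def[abs_def] by cases (auto intro!: holomorphic_intros)
  qed
  then have "smooth (\<lambda>x::real^3. (\<chi> i. Re (H i (of_real (x $ 3)))) :: real^3)"
    by (rule smooth_entire_profile)
  moreover have "Re (H i (of_real c)) = helix t \<delta> c $ i" for i c
  proof -
    have "H i (of_real c) = of_real (helix t \<delta> c $ i)"
      by (simp add: H_def helix_def tilt_def sin_of_real cos_of_real flip: of_real_mult)
    then show ?thesis by simp
  qed
  ultimately show ?thesis by simp
qed

lemma norm_helix: "norm (helix t \<delta> c) = 1"
proof -
  have "(S * p) * (S * p) + (S * q) * (S * q) + C * C = S\<^sup>2 * (p\<^sup>2 + q\<^sup>2) + C\<^sup>2" for S C p q :: real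
    by (simp add: power2_eq_square algebra_simps)
  note alg = this[of "sin (tilt \<delta> c)" "cos (t * c)" "sin (t * c)" "cos (tilt \<delta> c)"]
  have "helix t \<delta> c \<bullet> helix t \<delta> c
      = (sin (tilt \<delta> c))\<^sup>2 * ((cos (t * c))\<^sup>2 + (sin (t * c))\<^sup>2) + (cos (tilt \<delta> c))\<^sup>2"
    unfolding alg[symmetric] inner_vec_def sum_3 by (simp add: helix_def)
  then show ?thesis by (simp add: norm_eq_1)
qed

lemma helix_ends: "helix t \<delta> 0 = e3" "helix t \<delta> 1 = e3"
  by (auto simp: helix_def e3_def tilt_def vec_eq_iff forall_3 vector_3)

lemma norm_helix_deriv:
  "(norm (helix_deriv t \<delta> c))\<^sup>2 = (\<delta> * pi * cos (pi * c))\<^sup>2 + t\<^sup>2 * (sin (tilt \<delta> c))\<^sup>2"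
proof -
  define A S C p q where "A = \<delta> * pi * cos (pi * c)" "S = sin (tilt \<delta> c)" "C = cos (tilt \<delta> c)"
    "p = cos (t * c)" "q = sin (t * c)"
  have 1: "S\<^sup>2 + C\<^sup>2 = 1" "p\<^sup>2 + q\<^sup>2 = 1" by (simp_all add: A_S_C_p_q_def)
  have "(norm (helix_deriv t \<delta> c))\<^sup>2 = (A * C * p - t * S * q)\<^sup>2 + (A * C * q + t * S * p)\<^sup>2 + (A * S)\<^sup>2"
    unfolding power2_norm_eq_inner inner_vec_def
    by (simp add: sum_3 helix_deriv_def A_S_C_p_q_def power2_eq_square)
  also have "\<dots> = (A\<^sup>2 * C\<^sup>2 + t\<^sup>2 * S\<^sup>2) * (p\<^sup>2 + q\<^sup>2) + A\<^sup>2 * S\<^sup>2"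
    by (simp add: power2_eq_square algebra_simps)
  also have "\<dots> = A\<^sup>2 * (S\<^sup>2 + C\<^sup>2) + t\<^sup>2 * S\<^sup>2" by (simp add: 1(2) algebra_simps)
  finally show ?thesis by (simp add: 1(1)) (simp add: A_S_C_p_q_def)
qed

lemma helix_twist:
  "helix t \<delta> c $ 2 * helix_deriv t \<delta> c $ 1 - helix t \<delta> c $ 1 * helix_deriv t \<delta> c $ 2 = - t * (sin (tilt \<delta> c))\<^sup>2"
proof -
  define A S C p q where "A = \<delta> * pi * cos (pi * c)" "S = sin (tilt \<delta> c)" "C = cos (tilt \<delta> c)"
    "p = cos (t * c)" "q = sin (t * c)"
  have 1: "p\<^sup>2 + q\<^sup>2 = 1" by (simp add: A_S_C_p_q_def)
  have "helix t \<delta> c $ 2 * helix_deriv t \<delta> c $ 1 - helix t \<delta> c $ 1 * helix_deriv t \<delta> c $ 2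
      = S * q * (A * C * p - t * S * q) - S * p * (A * C * q + t * S * p)"
    by (simp add: helix_def helix_deriv_def A_S_C_p_q_def)
  also have "\<dots> = - t * S\<^sup>2 * (p\<^sup>2 + q\<^sup>2)" by (simp add: power2_eq_square algebra_simps)
  finally show ?thesis by (simp add: 1) (simp add: A_S_C_p_q_def)
qed

text \<open>The chord between \<open>e3\<close> and the helix is no longer than the arc, which is the tilt.\<close>

lemma norm_e3_minus_helix: "norm (e3 - helix t \<delta> c) \<le> \<bar>\<delta>\<bar>"
proof -
  have "(norm (e3 - helix t \<delta> c))\<^sup>2 = (norm e3)\<^sup>2 + (norm (helix t \<delta> c))\<^sup>2 - 2 * (e3 \<bullet> helix t \<delta> c)"
    by (simp add: power2_norm_eq_inner inner_diff_left inner_diff_right inner_commute)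
  also have "\<dots> = 2 - 2 * cos (2 * (tilt \<delta> c / 2))"
  proof -
    have "norm e3 = 1" using norm_helix[of t \<delta> 0] unfolding helix_ends .
    moreover have "e3 \<bullet> helix t \<delta> c = cos (tilt \<delta> c)"
      by (simp add: e3_def inner_vec_def sum_3 vector_3 helix_def)
    ultimately show ?thesis by (simp add: norm_helix)
  qed
  also have "\<dots> = (2 * sin (tilt \<delta> c / 2))\<^sup>2"
    unfolding cos_double_sin by (simp add: power_mult_distrib)
  finally have "norm (e3 - helix t \<delta> c) = \<bar>2 * sin (tilt \<delta> c / 2)\<bar>"
    by (metis abs_norm_cancel power2_eq_iff_nonneg abs_ge_zero power2_abs)
  also have "\<dots> \<le> \<bar>tilt \<delta> c\<bar>"
    using abs_sin_x_le_abs_x[of "tilt \<delta> c / 2"] by simp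
  also have "\<dots> \<le> \<bar>\<delta>\<bar>"
    unfolding tilt_def abs_mult by (rule mult_left_le) auto
  finally show ?thesis .
qed

lemma norm_helix_deriv_le: "norm (helix_deriv t \<delta> c) \<le> \<bar>\<delta>\<bar> * (pi + \<bar>t\<bar>)"
proof -
  have 1: "(\<delta> * pi * cos (pi * c))\<^sup>2 \<le> (\<delta> * pi)\<^sup>2"
    using mult_left_mono[OF abs_square_le_1[THEN iffD2, OF abs_cos_le_one[of "pi * c"]], of "(\<delta> * pi)\<^sup>2"]
    by (simp add: power_mult_distrib)
  have "\<bar>sin (tilt \<delta> c)\<bar> \<le> \<bar>\<delta>\<bar>"
    using abs_sin_x_le_abs_x[of "tilt \<delta> c"] mult_left_le[of "\<bar>sin (pi * c)\<bar>" "\<bar>\<delta>\<bar>"]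
    by (simp add: tilt_def abs_mult)
  then have "(sin (tilt \<delta> c))\<^sup>2 \<le> \<delta>\<^sup>2" by (simp add: abs_le_square_iff)
  then have 2: "t\<^sup>2 * (sin (tilt \<delta> c))\<^sup>2 \<le> t\<^sup>2 * \<delta>\<^sup>2" by (intro mult_left_mono) auto
  have "(norm (helix_deriv t \<delta> c))\<^sup>2 \<le> (\<delta> * pi)\<^sup>2 + t\<^sup>2 * \<delta>\<^sup>2"
    using 1 2 unfolding norm_helix_deriv by linarith
  also have "\<dots> = \<bar>\<delta>\<bar>\<^sup>2 * (pi\<^sup>2 + \<bar>t\<bar>\<^sup>2)"
    by (simp add: power_mult_distrib algebra_simps)
  also have "\<dots> \<le> \<bar>\<delta>\<bar>\<^sup>2 * (pi + \<bar>t\<bar>)\<^sup>2"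
    by (intro mult_left_mono) (auto simp: power2_sum)
  finally have "(norm (helix_deriv t \<delta> c))\<^sup>2 \<le> (\<bar>\<delta>\<bar> * (pi + \<bar>t\<bar>))\<^sup>2"
    by (simp only: power_mult_distrib)
  then show ?thesis by (rule power2_le_imp_le) (simp add: pi_ge_zero)
qed

lemma helix_close:
  assumes L: "L1 > 0" "L2 > 0"
  shows "W1inf_norm (box_domain L1 L2) (\<lambda>x. e3 - helix t \<delta> (x $ 3)) \<le> ereal (\<bar>\<delta>\<bar> * (1 + pi + \<bar>t\<bar>))"
proof -
  let ?\<Omega> = "box_domain L1 L2" and ?d = "\<lambda>x::real^3. e3 - helix t \<delta> (x $ 3)"
  have s: "smooth ?d"
    using smooth_helix[of t \<delta>] by (simp add: smooth_def C_k_diff C_k_const)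
  have d: "((\<lambda>c. e3 - helix t \<delta> c) has_vector_derivative - helix_deriv t \<delta> c) (at c)" for c
    by (auto intro!: derivative_eq_intros helix_has_vector_derivative)
  note wg = weak_grad_smooth[OF s L]
  have J: "norm (jacobian ?d (at x)) \<le> \<bar>\<delta>\<bar> * (pi + \<bar>t\<bar>)" for x
  proof -
    have "(norm (jacobian ?d (at x)))\<^sup>2 = (norm (- helix_deriv t \<delta> (x $ 3)))\<^sup>2"
      unfolding power2_norm_eq_inner inner_vec_def
      by (simp add: sum_3 jacobian_profile[where h = "\<lambda>c. e3 - helix t \<delta> c", OF d])
    then have "norm (jacobian ?d (at x)) = norm (helix_deriv t \<delta> (x $ 3))"
      by simp
    then show ?thesis using norm_helix_deriv_le by simp
  qed
  have "Linf_norm ?\<Omega> ?d \<le> ereal \<bar>\<delta>\<bar>"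
    unfolding Linf_norm_def
  proof (rule esssup_I)
    have "?d \<in> borel_measurable (lebesgue_on ?\<Omega>)"
      by (intro continuous_imp_measurable_on_sets_lebesgue smooth_imp_continuous_on s box_domain_measurable)
    then show "(\<lambda>x. ereal (norm (?d x))) \<in> borel_measurable (lebesgue_on ?\<Omega>)" by measurable
  qed (use norm_e3_minus_helix in auto)
  moreover have "Linf_norm ?\<Omega> (weak_grad ?\<Omega> ?d) \<le> ereal (\<bar>\<delta>\<bar> * (pi + \<bar>t\<bar>))"
    unfolding Linf_norm_def
  proof (rule esssup_I)
    have "(\<lambda>x. jacobian ?d (at x)) \<in> borel_measurable (lebesgue_on ?\<Omega>)"
      by (intro continuous_imp_measurable_on_sets_lebesgue smooth_continuous_on_jacobian_matrix s box_domain_measurable)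
    then have "weak_grad ?\<Omega> ?d \<in> borel_measurable (lebesgue_on ?\<Omega>)"
      by (rule measurable_AE_lebesgue_on[OF box_domain_measurable]) (use wg(2) in \<open>eventually_elim, simp\<close>)
    then show "(\<lambda>x. ereal (norm (weak_grad ?\<Omega> ?d x))) \<in> borel_measurable (lebesgue_on ?\<Omega>)" by measurable
    show "AE x in lebesgue_on ?\<Omega>. ereal (norm (weak_grad ?\<Omega> ?d x)) \<le> ereal (\<bar>\<delta>\<bar> * (pi + \<bar>t\<bar>))"
      using wg(2) by eventually_elim (use J in simp)
  qed
  ultimately have "Linf_norm ?\<Omega> ?d + Linf_norm ?\<Omega> (weak_grad ?\<Omega> ?d) \<le> ereal \<bar>\<delta>\<bar> + ereal (\<bar>\<delta>\<bar> * (pi + \<bar>t\<bar>))"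
    by (rule add_mono)
  then show ?thesis
    using wg(1) by (auto simp: W1inf_norm_def algebra_simps)
qed

text \<open>The difference of the two integrands is, up to a factor, the derivative of \<open>sin (pi z) cos (pi z)\<close>,
  which vanishes on both horizontal faces; their sum is \<open>1\<close>.\<close>

lemma integral_sin_cos_squares:
  assumes L: "L1 > 0" "L2 > 0"
  shows "(LINT x|lebesgue_on (box_domain L1 L2). (cos (pi * x $ 3))\<^sup>2) = (LINT x|lebesgue_on (box_domain L1 L2). (sin (pi * x $ 3))\<^sup>2)"
    and "0 < (LINT x|lebesgue_on (box_domain L1 L2). (sin (pi * x $ 3))\<^sup>2)"
proof -
  let ?\<Omega> = "box_domain L1 L2"
  note int = integrable_continuous_box_domain
  have c: "continuous_on ?\<Omega> (\<lambda>x. (cos (pi * x $ 3))\<^sup>2)" "continuous_on ?\<Omega> (\<lambda>x. (sin (pi * x $ 3))\<^sup>2)"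
    by (intro continuous_intros)+
  have "(LINT x|lebesgue_on ?\<Omega>. pi * (cos (pi * x $ 3))\<^sup>2 - pi * (sin (pi * x $ 3))\<^sup>2) = 0"
  proof -
    let ?l = "vector [- L1, - L2, 0] :: real^3" and ?u = "vector [L1, L2, 1] :: real^3"
    let ?f = "\<lambda>c. sin (pi * c) * cos (pi * c)" and ?f' = "\<lambda>c. pi * (cos (pi * c))\<^sup>2 - pi * (sin (pi * c))\<^sup>2"
    have d: "(?f has_real_derivative ?f' c) (at c within S)" for c S
      by (auto intro!: derivative_eq_intros simp: power2_eq_square algebra_simps)
    have "(LINT x|lebesgue_on (cbox ?l ?u). ?f' (x $ 3)) =
        (LINT p|lebesgue_on ({?l $ 1..?u $ 1} \<times> {?l $ 2..?u $ 2}). ?f (face 3 1 (?u $ 3) p $ 3))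
        - (LINT p|lebesgue_on ({?l $ 1..?u $ 1} \<times> {?l $ 2..?u $ 2}). ?f (face 3 1 (?l $ 3) p $ 3))"
      unfolding Z.face_nth
      by (rule Z.integral_partial_derivative[where f = "\<lambda>x. ?f (x $ 3)", unfolded Z.face_nth])
        (simp_all add: vector_3 d continuous_intros)
    then show ?thesis by (simp add: box_domain_def vector_3)
  qed
  then show eq: "(LINT x|lebesgue_on ?\<Omega>. (cos (pi * x $ 3))\<^sup>2) = (LINT x|lebesgue_on ?\<Omega>. (sin (pi * x $ 3))\<^sup>2)"
    using int[OF c(1)] int[OF c(2)] by simp
  have "(LINT x|lebesgue_on ?\<Omega>. (cos (pi * x $ 3))\<^sup>2) + (LINT x|lebesgue_on ?\<Omega>. (sin (pi * x $ 3))\<^sup>2)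
      = (LINT x|lebesgue_on ?\<Omega>. (cos (pi * x $ 3))\<^sup>2 + (sin (pi * x $ 3))\<^sup>2)"
    by (rule Bochner_Integration.integral_add[OF int[OF c(1)] int[OF c(2)], symmetric])
  also have "\<dots> > 0" using box_domain_volume_pos[OF L] by simp
  finally show "0 < (LINT x|lebesgue_on ?\<Omega>. (sin (pi * x $ 3))\<^sup>2)" using eq by simp
qed

text \<open>The density exceeds that of \<open>e3\<close> by \<open>\<theta>'^2 - t^2 sin^2 \<theta>\<close> for the tilt \<open>\<theta>\<close>. Once \<open>sin \<theta>\<close> is bounded
  below by \<open>\<rho> \<theta>\<close>, integration leaves at most \<open>\<delta>^2 (pi^2 - t^2 \<rho>^2)\<close> times the integral of \<open>sin^2 (pi z)\<close>.\<close>

lemma helix_energy_less: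
  assumes K: "K > 0" and L: "L1 > 0" "L2 > 0" and \<delta>: "\<delta> > 0" and t: "t > 0" and \<rho>: "pi < t * \<rho>"
    and sin_ge: "\<And>\<theta>. 0 \<le> \<theta> \<Longrightarrow> \<theta> \<le> \<delta> \<Longrightarrow> \<rho> * \<theta> \<le> sin \<theta>"
  shows "energy K t L1 L2 (\<lambda>x. helix t \<delta> (x $ 3)) < energy K t L1 L2 (\<lambda>x. e3)"
proof -
  let ?\<Omega> = "box_domain L1 L2"
  let ?S = "LINT x|lebesgue_on ?\<Omega>. (sin (pi * x $ 3))\<^sup>2"
  note int = integrable_continuous_box_domain
  have \<rho>0: "\<rho> > 0" using \<rho> t pi_gt_zero by (smt (verit) zero_less_mult_pos)
  have "(LINT x|lebesgue_on ?\<Omega>. (norm (helix_deriv t \<delta> (x $ 3)))\<^sup>2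
        + 2 * t * (helix t \<delta> (x $ 3) $ 2 * helix_deriv t \<delta> (x $ 3) $ 1 - helix t \<delta> (x $ 3) $ 1 * helix_deriv t \<delta> (x $ 3) $ 2) + t\<^sup>2)
      = (LINT x|lebesgue_on ?\<Omega>. (\<delta> * pi)\<^sup>2 * (cos (pi * x $ 3))\<^sup>2 - t\<^sup>2 * (sin (tilt \<delta> (x $ 3)))\<^sup>2 + t\<^sup>2)"
    unfolding norm_helix_deriv helix_twist
    by (intro Bochner_Integration.integral_cong refl) (simp add: power_mult_distrib power2_eq_square algebra_simps)
  also have "\<dots> \<le> (LINT x|lebesgue_on ?\<Omega>. (\<delta> * pi)\<^sup>2 * (cos (pi * x $ 3))\<^sup>2 - (t * \<rho> * \<delta>)\<^sup>2 * (sin (pi * x $ 3))\<^sup>2 + t\<^sup>2)"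
  proof (rule integral_mono)
    fix x assume "x \<in> space (lebesgue_on ?\<Omega>)"
    then have "0 \<le> x $ 3" "x $ 3 \<le> 1"
      by (auto simp: box_domain_def mem_box_cart vector_3 dest: spec[of _ 3])
    then have "0 \<le> sin (pi * x $ 3)" by (intro sin_ge_zero) auto
    then have tilt: "0 \<le> tilt \<delta> (x $ 3)" "tilt \<delta> (x $ 3) \<le> \<delta>"
      using \<delta> by (auto simp: tilt_def)
    have "(\<rho> * tilt \<delta> (x $ 3))\<^sup>2 \<le> (sin (tilt \<delta> (x $ 3)))\<^sup>2"
      using sin_ge[OF tilt] \<rho>0 tilt by (intro power_mono) auto
    then have "t\<^sup>2 * (\<rho> * tilt \<delta> (x $ 3))\<^sup>2 \<le> t\<^sup>2 * (sin (tilt \<delta> (x $ 3)))\<^sup>2" by (intro mult_left_mono) auto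
    then show "(\<delta> * pi)\<^sup>2 * (cos (pi * x $ 3))\<^sup>2 - t\<^sup>2 * (sin (tilt \<delta> (x $ 3)))\<^sup>2 + t\<^sup>2
        \<le> (\<delta> * pi)\<^sup>2 * (cos (pi * x $ 3))\<^sup>2 - (t * \<rho> * \<delta>)\<^sup>2 * (sin (pi * x $ 3))\<^sup>2 + t\<^sup>2"
      by (simp add: tilt_def power_mult_distrib mult.assoc)
  qed (unfold tilt_def, (intro int continuous_intros)+)
  also have "\<dots> = (\<delta> * pi)\<^sup>2 * ?S - (t * \<rho> * \<delta>)\<^sup>2 * ?S + (LINT x|lebesgue_on ?\<Omega>. t\<^sup>2)"
  proof -
    have i: "integrable (lebesgue_on ?\<Omega>) (\<lambda>x. (cos (pi * x $ 3))\<^sup>2)" "integrable (lebesgue_on ?\<Omega>) (\<lambda>x. (sin (pi * x $ 3))\<^sup>2)"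
      "integrable (lebesgue_on ?\<Omega>) (\<lambda>x. t\<^sup>2)"
      by (intro int continuous_intros)+
    then show ?thesis by (simp add: integral_sin_cos_squares(1)[OF L])
  qed
  also have "\<dots> < (LINT x|lebesgue_on ?\<Omega>. t\<^sup>2)"
  proof -
    have "(\<delta> * pi)\<^sup>2 < (t * \<rho> * \<delta>)\<^sup>2"
      using \<rho> \<delta> by (intro power_strict_mono) (auto simp: mult.commute)
    then show ?thesis using integral_sin_cos_squares(2)[OF L] by simp
  qed
  finally show ?thesis
    using K unfolding energy_profile[OF smooth_helix helix_has_vector_derivative L] energy_e3[OF L] by simp
qed

lemma e3_not_weak_local_minimizer:
  assumes K: "K > 0" and t: "t > pi" and L: "L1 > 0" "L2 > 0"
  shows "\<not> weak_local_minimizer (box_domain L1 L2) (admissible L1 L2) (energy K t L1 L2) (\<lambda>x. e3)"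
proof
  assume "weak_local_minimizer (box_domain L1 L2) (admissible L1 L2) (energy K t L1 L2) (\<lambda>x. e3)"
  then obtain \<epsilon> where \<epsilon>: "\<epsilon> > 0" and min: "\<And>m. m \<in> admissible L1 L2 \<Longrightarrow>
      W1inf_norm (box_domain L1 L2) (\<lambda>x. e3 - m x) < ereal \<epsilon> \<Longrightarrow> energy K t L1 L2 (\<lambda>x. e3) \<le> energy K t L1 L2 m"
    unfolding weak_local_minimizer_def by blast
  have t0: "t > 0" using t pi_gt_zero by linarith
  \<comment> \<open>Halfway between \<open>pi / t\<close> and \<open>1\<close>, the slope of the sine function at \<open>0\<close>.\<close>
  define \<rho> where "\<rho> = (1 + pi / t) / 2"
  have \<rho>: "\<rho> < 1" "pi < t * \<rho>" using t t0 by (auto simp: \<rho>_def field_simps)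
  have "((\<lambda>h. sin h / h) \<longlongrightarrow> 1) (at (0::real))"
    using DERIV_sin[of "0::real"] by (simp add: DERIV_def)
  then have "\<forall>\<^sub>F h in at 0. \<rho> < sin h / h" using \<rho>(1) by (rule order_tendstoD)
  then obtain r where r: "r > 0" "\<And>h. h \<noteq> 0 \<Longrightarrow> \<bar>h\<bar> < r \<Longrightarrow> \<rho> < sin h / h"
    by (auto simp: eventually_at dist_real_def)
  define C where "C = 1 + pi + \<bar>t\<bar>"
  have C: "C > 0" using pi_gt_zero by (simp add: C_def add_pos_nonneg)
  define \<delta> where "\<delta> = min (r / 2) (\<epsilon> / (2 * C))"
  have \<delta>: "\<delta> > 0" "\<delta> < r" using r(1) \<epsilon> C by (auto simp: \<delta>_def)
  have "\<delta> * C \<le> \<epsilon> / (2 * C) * C" using C by (intro mult_right_mono) (auto simp: \<delta>_def)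
  also have "\<dots> < \<epsilon>" using \<epsilon> C by simp
  finally have "\<delta> * C < \<epsilon>" .
  then have "W1inf_norm (box_domain L1 L2) (\<lambda>x. e3 - helix t \<delta> (x $ 3)) < ereal \<epsilon>"
    using helix_close[OF L, of t \<delta>] \<delta>(1) unfolding C_def by (simp add: le_less_trans)
  moreover have "(\<lambda>x. helix t \<delta> (x $ 3)) \<in> admissible L1 L2"
    by (intro profile_admissible smooth_helix norm_helix helix_ends L)
  moreover have "\<rho> * \<theta> \<le> sin \<theta>" if "0 \<le> \<theta>" "\<theta> \<le> \<delta>" for \<theta>
    using r(2)[of \<theta>] that \<delta>(2) by (cases "\<theta> = 0") (auto simp: field_simps)
  then have "energy K t L1 L2 (\<lambda>x. helix t \<delta> (x $ 3)) < energy K t L1 L2 (\<lambda>x. e3)"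
    by (intro helix_energy_less[OF K L \<delta>(1) t0 \<rho>(2)])
  ultimately show False using min by fastforce
qed

theorem proposition22:
  fixes K t L1 L2 :: real
  assumes "K > 0" and "t \<ge> 0" and "L1 > 0" and "L2 > 0"
  shows "(t < pi \<longrightarrow> strict_strong_local_minimizer (box_domain L1 L2) (admissible L1 L2)
            (energy K t L1 L2) (\<lambda>x. e3)) \<and>
         (t > pi \<longrightarrow> \<not> weak_local_minimizer (box_domain L1 L2) (admissible L1 L2)
            (energy K t L1 L2) (\<lambda>x. e3))"
proof (intro conjI impI)
  assume "t < pi"
  then show "strict_strong_local_minimizer (box_domain L1 L2) (admissible L1 L2) (energy K t L1 L2) (\<lambda>x. e3)"
    using assms by (intro e3_strict_strong_local_minimizer e3_admissible energy_e3)
next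
  assume "t > pi"
  then show "\<not> weak_local_minimizer (box_domain L1 L2) (admissible L1 L2) (energy K t L1 L2) (\<lambda>x. e3)"
    using assms by (intro e3_not_weak_local_minimizer)
qed

end
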